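(* Let $V\subseteq\mathbb{R}^n$ be a closed cone with $V\setminus\{0\}\neq\emptyset$ and $V':=\operatorname{int}V^*\neq\emptyset$. Let $\psi\in\mathcal{C}^\infty(\mathbb{R}^n)$ be such that $(x,\xi)\mapsto\psi(\xi)$ belongs to $S^0_{1,0}(\mathbb{R}^{2n})$, i.e. $\sup_{\xi\in\mathbb{R}^n}\langle\xi\rangle^{|\alpha|}|\partial^\alpha\psi(\xi)|<\infty$ for all $\alpha\in\mathbb{N}^n$. Assume that $\operatorname{Re}\psi$ is positively homogeneous of order $0$ and that $\operatorname{supp}(\operatorname{Re}\psi)\subseteq V$. Let $\varphi_1:\mathbb{S}^{n-1}\to\mathbb{R}$ be the continuous function $\varphi_1(\omega):=\lim_{r\to\infty}\operatorname{Re}\psi(r\omega)$. If $\varphi_1$ or $-\varphi_1$ satisfies condition $(\ast)$ (relative to $V'$; stated in the context), then there are $f\in L^1_{\mathrm{comp}}(\mathbb{R}^n)$, $g\in L^\infty_{\mathrm{comp}}(\mathbb{R}^n)$ and $\varphi\in\mathcal{K}(\mathbb{R}^n)$ such that $\psi(D)f\notin L^1_{\mathrm{loc}}(\mathbb{R}^n)$, $\psi(D)g\notin L^\infty_{\mathrm{loc}}(\mathbb{R}^n)$ and $\psi(D)\varphi\notin\mathcal{C}(\mathbb{R}^n)$. The same conclusion holds if these assumptions are satisfied by $\operatorname{Im}\psi$ instead of $\operatorname{Re}\psi$ (that is, $\operatorname{Im}\psi$ is positively homogeneous of order $0$, $\operatorname{supp}(\operatorname{Im}\psi)\subseteq V$,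 and $\varphi_1$ or $-\varphi_1$ satisfies $(\ast)$ with $\varphi_1(\omega):=\lim_{r\to\infty}\operatorname{Im}\psi(r\omega)$).
   Context: A cone in $\mathbb{R}^n$ is a set stable under multiplication by positive scalars. For a cone $V$, its dual cone is $V^*:=\{x\in\mathbb{R}^n \mid xy\ge 0\ \ \forall y\in V\}$, where $xy$ is the Euclidean inner product. $\mathbb{S}^{n-1}$ is the unit sphere with its surface measure $d\omega$ (counting measure when $n=1$), and $\langle\xi\rangle=(1+|\xi|^2)^{1/2}$. A function $\psi:\mathbb{R}^n\to\mathbb{C}$ is positively homogeneous of order $0$ if there is $R>0$ such that $\psi(\lambda\xi)=\psi(\xi)$ for all $|\xi|>R$, $\lambda>1$. Condition $(\ast)$: for a real-valued $\phi\in L^\infty(\mathbb{S}^{n-1})$ with $\operatorname{supp}\phi\subseteq\mathbb{S}^{n-1}\cap V$, set $\phi_+:=\max\{\phi,0\}$, $\phi_-:=\max\{-\phi,0\}$ and $$\kappa_0(\phi):=\sup_{\omega'\in\mathbb{S}^{n-1}\cap V'}\Big(\inf_{\omega\in\operatorname{supp}\phi_-}\omega\omega'\Big),$$ with $\kappa_0(\phi)=\infty$ (and $\kappa_0(\phi)^{-n}=0$) if $\operatorname{supp}\phi_-=\emptyset$. Then $\phi$ satisfies $(\ast)$ if $$\int_{\mathbb{S}^{n-1}}\phi_+(\omega)\,d\omega>\kappa_0(\phi)^{-n}\int_{\mathbb{S}^{n-1}}\phi_-(\omega)\,d\omega.\qquad(\ast)$$ Fourier transform: $\mathcal{F}f(\xi)=\int_{\mathbb{R}^n}e^{-ix\xi}f(x)\,dx$,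 extended to $\mathcal{S}'(\mathbb{R}^n)$; $\psi(D):\mathcal{S}'(\mathbb{R}^n)\to\mathcal{S}'(\mathbb{R}^n)$ is $\psi(D)u=\mathcal{F}^{-1}(\psi\,\mathcal{F}u)$. $L^p_{\mathrm{comp}}(\mathbb{R}^n)$ is the space of compactly supported elements of $L^p(\mathbb{R}^n)$, $L^p_{\mathrm{loc}}(\mathbb{R}^n)$ the space of functions locally in $L^p$, $\mathcal{K}(\mathbb{R}^n)$ the space of continuous functions with compact support, and $\mathcal{C}(\mathbb{R}^n)$ the space of continuous functions. Statements such as $\psi(D)f\notin L^1_{\mathrm{loc}}(\mathbb{R}^n)$ mean that the distribution $\psi(D)f$ is not given by an element of that space. *)

theory Defs
  imports "HOL-Analysis.Analysis"
begin

section \<open>Cones\<close>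

text \<open>The library's \<^const>\<open>cone\<close> also allows the scalar \<open>0\<close>; here only positive scalars occur.\<close>

definition pos_cone :: "'a::real_vector set \<Rightarrow> bool" where
  "pos_cone V \<longleftrightarrow> (\<forall>x\<in>V. \<forall>c>0. c *\<^sub>R x \<in> V)"

definition dual_cone :: "'a::real_inner set \<Rightarrow> 'a set" where
  "dual_cone V = {x. \<forall>y\<in>V. x \<bullet> y \<ge> 0}"


section \<open>Surface measure on the unit sphere\<close>

text \<open>
  The surface measure of \<open>A\<close> is \<open>n\<close> times the volume of \<open>{r \<omega> | 0 < r < 1, \<omega> \<in> A}\<close>, which is the
  measure \<open>d\<omega>\<close> of the polar coordinate formula \<open>dx = r\<^sup>n\<^sup>-\<^sup>1 dr d\<omega>\<close>.
  For \<open>n = 1\<close> both points of the sphere get mass \<open>1\<close>, i.e. it is the counting measure.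
\<close>

definition sphere_measure :: "(real ^ 'n) measure" where
  "sphere_measure = scale_measure (of_nat CARD('n))
     (distr (restrict_space lborel (ball 0 1 - {0})) (restrict_space borel (sphere 0 1))
       (\<lambda>x. x /\<^sub>R norm x))"

lemma emeasure_sphere_measure:
  fixes A :: "(real ^ 'n) set"
  assumes A: "A \<in> sets borel" "A \<subseteq> sphere 0 1"
  shows "emeasure sphere_measure A =
    of_nat CARD('n) * emeasure lborel {x \<in> ball 0 1 - {0}. x /\<^sub>R norm x \<in> A}"
proof -
  let ?B = "ball 0 1 - {0::real ^ 'n}"
  have B: "?B \<in> sets lborel" by simp
  have m: "(\<lambda>x. x /\<^sub>R norm x) \<in> restrict_space lborel ?B \<rightarrow>\<^sub>M restrict_space borel (sphere 0 1)"
    by (intro measurable_restrict_space3) (auto simp: dist_norm)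
  have A': "A \<in> sets (restrict_space borel (sphere 0 1))"
    using A by (simp add: sets_restrict_space_iff)
  have eq: "(\<lambda>x. x /\<^sub>R norm x) -` A \<inter> space (restrict_space lborel ?B)
      = {x \<in> ?B. x /\<^sub>R norm x \<in> A}"
    by (auto simp: space_restrict_space)
  have "emeasure (distr (restrict_space lborel ?B) (restrict_space borel (sphere 0 1)) (\<lambda>x. x /\<^sub>R norm x)) A
      = emeasure (restrict_space lborel ?B) {x \<in> ?B. x /\<^sub>R norm x \<in> A}"
    unfolding emeasure_distr[OF m A'] eq ..
  also have "\<dots> = emeasure lborel {x \<in> ?B. x /\<^sub>R norm x \<in> A}"
    by (rule emeasure_restrict_space) (use B in auto)
  finally show ?thesis
    unfolding sphere_measure_def by (simp only: emeasure_scale_measure)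
qed


section \<open>Condition \<open>(\<ast>)\<close>\<close>

text \<open>
  The support of an element of \<open>L\<^sup>\<infinity>\<close> of the sphere: the complement of the largest relatively
  open set on which it vanishes almost everywhere. For continuous functions this is the
  closure of the set where the function does not vanish.
\<close>

definition sphere_supp :: "(real ^ 'n \<Rightarrow> real) \<Rightarrow> (real ^ 'n) set" where
  "sphere_supp \<phi> = {\<omega> \<in> sphere 0 1.
     \<forall>U. open U \<and> \<omega> \<in> U \<longrightarrow> \<not> (AE \<eta> in sphere_measure. \<eta> \<in> U \<longrightarrow> \<phi> \<eta> = 0)}"

definition pos_part :: "('a \<Rightarrow> real) \<Rightarrow> 'a \<Rightarrow> real" where
  "pos_part \<phi> x = max (\<phi> x) 0"

definition neg_part :: "('a \<Rightarrow> real) \<Rightarrow> 'a \<Rightarrow> real" where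
  "neg_part \<phi> x = max (- \<phi> x) 0"

definition kappa0 :: "(real ^ 'n) set \<Rightarrow> (real ^ 'n \<Rightarrow> real) \<Rightarrow> ereal" where
  "kappa0 V \<phi> =
     (if sphere_supp (neg_part \<phi>) = {} then \<infinity>
      else (SUP \<omega>' \<in> sphere 0 1 \<inter> interior (dual_cone V).
              INF \<omega> \<in> sphere_supp (neg_part \<phi>). ereal (\<omega> \<bullet> \<omega>')))"

text \<open>In \<^typ>\<open>ereal\<close>, \<open>inverse (\<infinity> ^ n) = 0\<close> for \<open>n \<ge> 1\<close>.\<close>

definition condition_star :: "(real ^ 'n) set \<Rightarrow> (real ^ 'n \<Rightarrow> real) \<Rightarrow> bool" where
  "condition_star V \<phi> \<longleftrightarrow>
     \<phi> \<in> borel_measurable sphere_measure \<and>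
     (\<exists>C. AE \<omega> in sphere_measure. \<bar>\<phi> \<omega>\<bar> \<le> C) \<and>
     sphere_supp \<phi> \<subseteq> sphere 0 1 \<inter> V \<and>
     ereal (LINT \<omega>|sphere_measure. pos_part \<phi> \<omega>)
       > inverse (kappa0 V \<phi> ^ CARD('n)) * ereal (LINT \<omega>|sphere_measure. neg_part \<phi> \<omega>)"


section \<open>Smooth functions and symbols\<close>

definition partial_deriv :: "'n \<Rightarrow> (real ^ 'n \<Rightarrow> complex) \<Rightarrow> real ^ 'n \<Rightarrow> complex" where
  "partial_deriv i f x = vector_derivative (\<lambda>t. f (x + t *\<^sub>R axis i 1)) (at 0)"

text \<open>
  A multi-index \<open>\<alpha>\<close> is represented by a list of coordinates in which \<open>i\<close> occurs \<open>\<alpha>\<^sub>i\<close> times, so that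
  \<open>|\<alpha>|\<close> is the length of the list. For smooth functions the order in the list is irrelevant.
\<close>

definition iter_deriv :: "'n list \<Rightarrow> (real ^ 'n \<Rightarrow> complex) \<Rightarrow> real ^ 'n \<Rightarrow> complex" where
  "iter_deriv is f = foldr partial_deriv is f"

definition smooth :: "(real ^ 'n \<Rightarrow> complex) \<Rightarrow> bool" where
  "smooth f \<longleftrightarrow> (\<forall>is x. iter_deriv is f differentiable (at x))"

definition japanese_bracket :: "real ^ 'n \<Rightarrow> real" where
  "japanese_bracket \<xi> = sqrt (1 + (norm \<xi>)\<^sup>2)"

definition symbol_S0 :: "(real ^ 'n \<Rightarrow> complex) \<Rightarrow> bool" where
  "symbol_S0 \<psi> \<longleftrightarrow> smooth \<psi> \<and>
     (\<forall>is. bdd_above (range (\<lambda>\<xi>. japanese_bracket \<xi> ^ length is * norm (iter_deriv is \<psi> \<xi>))))"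

definition pos_homogeneous0 :: "(real ^ 'n \<Rightarrow> 'b) \<Rightarrow> bool" where
  "pos_homogeneous0 h \<longleftrightarrow>
     (\<exists>R>0. \<forall>\<xi> l. norm \<xi> > R \<longrightarrow> l > 1 \<longrightarrow> h (l *\<^sub>R \<xi>) = h \<xi>)"

definition supp :: "('a::topological_space \<Rightarrow> 'b::zero) \<Rightarrow> 'a set" where
  "supp f = closure {x. f x \<noteq> 0}"

definition radial_limit :: "(real ^ 'n \<Rightarrow> real) \<Rightarrow> real ^ 'n \<Rightarrow> real" where
  "radial_limit h \<omega> = Lim at_top (\<lambda>r. h (r *\<^sub>R \<omega>))"


section \<open>Distributions, Fourier transform, Fourier multipliers\<close>

text \<open>
  A tempered distribution is represented by its action on Schwartz functions; the values of the
  functional at other functions are irrelevant. The operations on tempered distributions are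
  the usual extensions by duality, with respect to the bilinear pairing \<open>\<integral> f \<eta>\<close>.
\<close>

type_synonym 'n distrib = "(real ^ 'n \<Rightarrow> complex) \<Rightarrow> complex"

definition fourier :: "(real ^ 'n \<Rightarrow> complex) \<Rightarrow> real ^ 'n \<Rightarrow> complex" where
  "fourier f \<xi> = (LINT x|lebesgue. exp (- \<i> * complex_of_real (x \<bullet> \<xi>)) * f x)"

definition inv_fourier :: "(real ^ 'n \<Rightarrow> complex) \<Rightarrow> real ^ 'n \<Rightarrow> complex" where
  "inv_fourier f x =
     (LINT \<xi>|lebesgue. exp (\<i> * complex_of_real (x \<bullet> \<xi>)) * f \<xi>) / complex_of_real ((2 * pi) ^ CARD('n))"

definition dist_of :: "(real ^ 'n \<Rightarrow> complex) \<Rightarrow> 'n distrib" where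
  "dist_of f \<eta> = (LINT x|lebesgue. f x * \<eta> x)"

definition dist_fourier :: "'n distrib \<Rightarrow> 'n::finite distrib" where
  "dist_fourier u \<eta> = u (fourier \<eta>)"

definition dist_inv_fourier :: "'n distrib \<Rightarrow> 'n::finite distrib" where
  "dist_inv_fourier u \<eta> = u (inv_fourier \<eta>)"

definition dist_mult :: "(real ^ 'n \<Rightarrow> complex) \<Rightarrow> 'n distrib \<Rightarrow> 'n distrib" where
  "dist_mult \<psi> u \<eta> = u (\<lambda>\<xi>. \<psi> \<xi> * \<eta> \<xi>)"

definition psi_D :: "(real ^ 'n \<Rightarrow> complex) \<Rightarrow> 'n distrib \<Rightarrow> 'n::finite distrib" where
  "psi_D \<psi> u = dist_inv_fourier (dist_mult \<psi> (dist_fourier u))"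

definition test_function :: "(real ^ 'n \<Rightarrow> complex) \<Rightarrow> bool" where
  "test_function \<eta> \<longleftrightarrow> smooth \<eta> \<and> compact (supp \<eta>)"

text \<open>
  Locally integrable functions need not define tempered distributions, hence equality is
  tested on \<open>C\<^sub>c\<^sup>\<infinity>\<close>, which is dense in the Schwartz space.
\<close>

definition given_by_elem :: "'n distrib \<Rightarrow> (real ^ 'n \<Rightarrow> complex) set \<Rightarrow> bool" where
  "given_by_elem u X \<longleftrightarrow> (\<exists>h\<in>X. \<forall>\<eta>. test_function \<eta> \<longrightarrow> u \<eta> = dist_of h \<eta>)"


section \<open>Function spaces\<close>

text \<open>Elements of Lebesgue spaces are represented by functions; compactness of the support is
  required up to null sets.\<close>

definition ess_compact_supp :: "(real ^ 'n \<Rightarrow> complex) \<Rightarrow> bool" where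
  "ess_compact_supp f \<longleftrightarrow> (\<exists>K. compact K \<and> (AE x in lebesgue. x \<notin> K \<longrightarrow> f x = 0))"

definition L1_comp :: "(real ^ 'n \<Rightarrow> complex) set" where
  "L1_comp = {f. integrable lebesgue f \<and> ess_compact_supp f}"

definition Linf_comp :: "(real ^ 'n \<Rightarrow> complex) set" where
  "Linf_comp = {f. f \<in> borel_measurable lebesgue \<and>
     (\<exists>C. AE x in lebesgue. norm (f x) \<le> C) \<and> ess_compact_supp f}"

definition L1_loc :: "(real ^ 'n \<Rightarrow> complex) set" where
  "L1_loc = {f. f \<in> borel_measurable lebesgue \<and> (\<forall>K. compact K \<longrightarrow> set_integrable lebesgue K f)}"

definition Linf_loc :: "(real ^ 'n \<Rightarrow> complex) set" where
  "Linf_loc = {f. f \<in> borel_measurable lebesgue \<and>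
     (\<forall>K. compact K \<longrightarrow> (\<exists>C. AE x in lebesgue. x \<in> K \<longrightarrow> norm (f x) \<le> C))}"

definition cont_functions :: "(real ^ 'n \<Rightarrow> complex) set" where
  "cont_functions = {f. continuous_on UNIV f}"

definition cont_comp :: "(real ^ 'n \<Rightarrow> complex) set" where
  "cont_comp = {f. continuous_on UNIV f \<and> compact (supp f)}"

end

theory Submission
  imports Defs "HOL-Probability.Characteristic_Functions" "HOL-Probability.Sinc_Integral"
begin

text \<open>
  Let \<open>h\<close> be the real (or imaginary) part of \<open>\<psi>\<close> and \<open>h\<^sub>0\<close> its limit at infinity, homogeneous of degree zero.
  Condition \<open>(\<ast>)\<close> provides a direction in which \<open>h\<^sub>0\<close> is not zero. For \<open>w\<close> in the interior of the dual
  cone, \<open>-w\<close> is not in \<open>V\<close>, so \<open>h\<^sub>0\<close> vanishes there, and \<open>h\<^sub>0\<close> is not constant on the sphere. The idea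
  is that the Fourier transform of a non-constant function homogeneous of degree zero is not a measure: it would be
  a finite measure invariant under dilations, hence a multiple of the point mass, whose transform is constant.
  On the other hand, a multiplier mapping compactly supported integrable functions to locally
  integrable functions has a kernel that is locally a measure, and similarly for bounded or continuous functions.

  The proof makes this quantitative and works with test functions only.
  With \<open>inv_fourier \<eta>\<close> real valued, the number \<open>\<integral> \<psi> \<cdot> inv_fourier \<eta>\<close> is the kernel tested against \<open>\<eta>\<close>, and its real or
  imaginary part involves only \<open>h\<close>, whatever the other part of \<open>\<psi>\<close> is. The lemma \<open>unbounded_kernel\<close> makes it
  arbitrarily large for \<open>|\<eta>| \<le> 1\<close> supported in the unit cube. Here \<open>\<eta>\<close> is, up to a constant factor, a sum of \<open>N\<close> dyadic dilates of
  \<open>(e\<^bsup>-ix\<xi>\<^sub>0\<^esup> - e\<^bsup>-ix\<xi>\<^sub>1\<^esup>) \<chi>(b x)\<close>, where \<open>h\<^sub>0\<close> takes different values at \<open>\<xi>\<^sub>0\<close> and \<open>\<xi>\<^sub>1\<close>. Each dilate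
  contributes almost the same nonzero amount, since \<open>h\<^sub>0\<close> is invariant under dilations; the sum is bounded uniformly
  in \<open>N\<close>, since the function vanishes at the origin and has compact support.

  The lemma \<open>ill_posed\<close> turns unboundedness into single functions \<open>f\<close>, \<open>g\<close>, \<open>\<phi>\<close>. An approximate identity in place of
  the point mass, and the symmetry of the pairing \<open>\<integral> \<psi> \<cdot> inv_fourier \<eta> \<cdot> fourier u\<close>, show that \<open>\<psi>(D)\<close> is unbounded from
  \<open>L\<^sup>1\<close> to \<open>L\<^sup>1\<close> and from bounded continuous functions to \<open>L\<^sup>\<infinity>\<close> over the unit cube; \<open>gliding_hump\<close> then
  sums a series of bad functions. All test functions belong to an explicit algebra of smooth functions, built from
  characters and from \<open>exp(-1/t)\<close>; on the Fourier side everything comes down to one cutoff function, whose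
  transform is real valued and integrable with nonzero integral.
\<close>

section \<open>The gliding hump method\<close>

text \<open>
  A form of the uniform boundedness principle for a family of functionals \<open>B \<cdot> \<eta>\<close>: unboundedness
  on the product \<open>U \<times> E\<close> produces a single \<open>f\<close> at which the family over \<open>E\<close> is unbounded. The argument
  is Sokal's. With \<open>T \<eta>\<close> the supremum of \<open>|B u \<eta>|\<close> over \<open>U\<close>, choose \<open>\<eta>\<^sub>n\<close> with \<open>T \<eta>\<^sub>n \<ge> 16\<^sup>n\<close> and
  an almost extremal \<open>u\<^sub>n\<close>, and put \<open>f = \<Sum> s\<^sub>n 4\<^sup>-\<^sup>n u\<^sub>n\<close>. Including or omitting the \<open>n\<close>-th summand moves the partial
  sum of \<open>B f \<eta>\<^sub>n\<close> by at least \<open>9/10 T \<eta>\<^sub>n 4\<^sup>-\<^sup>n\<close>, so one of the two choices of \<open>s\<^sub>n\<close> makes it at least half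
  of that, while all later summands contribute at most \<open>1/3 T \<eta>\<^sub>n 4\<^sup>-\<^sup>n\<close>. The hypothesis on
  series takes the place of completeness: it is where \<open>f\<close> in the class \<open>F\<close> comes from.
\<close>

lemma gliding_hump:
  fixes B :: "'u \<Rightarrow> 'e \<Rightarrow> complex"
  assumes bdd: "\<And>\<eta>. \<eta> \<in> E \<Longrightarrow> \<exists>M. \<forall>u\<in>U. norm (B u \<eta>) \<le> M"
    and sums: "\<And>u s. (\<And>k. u k \<in> U) \<Longrightarrow> (\<And>k::nat. s k \<in> {0, 1::real}) \<Longrightarrow>
      \<exists>f\<in>F. \<forall>\<eta>\<in>E. (\<lambda>k. of_real (s k / 4 ^ k) * B (u k) \<eta>) sums B f \<eta>"
    and unbdd: "\<And>M. \<exists>u\<in>U. \<exists>\<eta>\<in>E. norm (B u \<eta>) > M"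
  shows "\<exists>f\<in>F. \<forall>M. \<exists>\<eta>\<in>E. norm (B f \<eta>) > M"
proof -
  define T where "T \<eta> = (SUP u\<in>U. norm (B u \<eta>))" for \<eta>
  have T_upper: "norm (B u \<eta>) \<le> T \<eta>" if "u \<in> U" "\<eta> \<in> E" for u \<eta>
    unfolding T_def using bdd[OF that(2)] that(1) by (intro cSUP_upper) (auto simp: bdd_above_def)
  have "\<exists>\<eta>\<in>E. \<exists>u\<in>U. T \<eta> \<ge> 16 ^ n \<and> norm (B u \<eta>) > 9 / 10 * T \<eta>" for n :: nat
  proof -
    obtain v \<eta> where v: "v \<in> U" "\<eta> \<in> E" "norm (B v \<eta>) > 16 ^ n"
      using unbdd by blast
    then have T: "T \<eta> \<ge> 16 ^ n" using T_upper[of v \<eta>] by linarith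
    then have "T \<eta> > 0" by (smt (verit) zero_less_power)
    then have "9 / 10 * T \<eta> < (SUP u\<in>U. norm (B u \<eta>))" unfolding T_def[symmetric] by simp
    then obtain u where "u \<in> U" "9 / 10 * T \<eta> < norm (B u \<eta>)"
      using less_cSUP_iff[of U "\<lambda>u. norm (B u \<eta>)" "9 / 10 * T \<eta>"] bdd[OF v(2)] v(1)
      by (force simp: bdd_above_def)
    then show ?thesis using v T by blast
  qed
  then obtain \<eta> u where \<eta>: "\<And>n::nat. \<eta> n \<in> E" and u: "\<And>n. u n \<in> U"
    and T_ge: "\<And>n. T (\<eta> n) \<ge> 16 ^ n" and hump: "\<And>n. norm (B (u n) (\<eta> n)) > 9 / 10 * T (\<eta> n)"
    by metis
  define summand where "summand k n r = of_real (r / 4 ^ k) * B (u k) (\<eta> n)" for k n :: nat and r :: real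
  define P where "P s n r \<longleftrightarrow> r \<in> {0, 1} \<and>
      norm ((\<Sum>k<n. summand k n (s k)) + summand n n r) \<ge> norm (summand n n 1) / 2"
    for s :: "nat \<Rightarrow> real" and n r
  have "\<exists>s. \<forall>n. P s n (s n)"
  proof (rule dependent_wf_choice[where R = less_than])
    fix f g :: "nat \<Rightarrow> real" and n r
    assume "\<And>z. (z, n) \<in> less_than \<Longrightarrow> f z = g z"
    then have "(\<Sum>k<n. summand k n (f k)) = (\<Sum>k<n. summand k n (g k))" by (intro sum.cong) auto
    then show "P f n r = P g n r" by (simp add: P_def)
  next
    fix n and s :: "nat \<Rightarrow> real"
    \<comment> \<open>Two numbers at distance \<open>d\<close> cannot both lie in the disc of radius less than \<open>d/2\<close>.\<close>
    let ?a = "\<Sum>k<n. summand k n (s k)"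
    have "norm (summand n n 1) \<le> norm (?a + summand n n 1) + norm ?a"
      using norm_triangle_ineq4[of "?a + summand n n 1" ?a] by simp
    then have "norm ?a \<ge> norm (summand n n 1) / 2 \<or> norm (?a + summand n n 1) \<ge> norm (summand n n 1) / 2"
      by linarith
    then show "\<exists>r. P s n r"
    proof
      assume "norm ?a \<ge> norm (summand n n 1) / 2"
      then have "P s n 0" by (simp add: P_def summand_def)
      then show ?thesis ..
    next
      assume "norm (?a + summand n n 1) \<ge> norm (summand n n 1) / 2"
      then have "P s n 1" by (simp add: P_def)
      then show ?thesis ..
    qed
  qed simp
  then obtain s where s: "\<And>n. P s n (s n)" by blast
  then have s01: "s k \<in> {0, 1}" for k by (simp add: P_def)
  obtain f where f: "f \<in> F" and f_sums: "\<And>n. (\<lambda>k. summand k n (s k)) sums B f (\<eta> n)"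
    using sums[of u s] u s01 \<eta> unfolding summand_def by blast
  have large: "norm (B f (\<eta> n)) \<ge> 7 / 60 * 4 ^ n" for n
  proof -
    let ?S = "\<Sum>k<Suc n. summand k n (s k)"
    have summand_le: "norm (summand (k + Suc n) n (s (k + Suc n))) \<le> T (\<eta> n) / 4 ^ Suc n * (1 / 4) ^ k" for k
    proof -
      have "norm (summand (k + Suc n) n (s (k + Suc n)))
          = s (k + Suc n) / 4 ^ (k + Suc n) * norm (B (u (k + Suc n)) (\<eta> n))"
        using s01[of "k + Suc n"] by (auto simp: summand_def norm_mult norm_divide norm_power)
      also have "\<dots> \<le> 1 / 4 ^ (k + Suc n) * T (\<eta> n)"
        using s01[of "k + Suc n"] T_upper[OF u \<eta>] by (intro mult_mono divide_right_mono) auto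
      finally show ?thesis by (simp add: power_add power_divide mult_ac)
    qed
    have geo: "(\<lambda>k. T (\<eta> n) / 4 ^ Suc n * (1 / 4 :: real) ^ k) sums (T (\<eta> n) / 4 ^ Suc n * (4 / 3))"
      using sums_mult[OF geometric_sums[of "1 / 4 :: real"], of "T (\<eta> n) / 4 ^ Suc n"] by simp
    have "(\<lambda>k. summand (k + Suc n) n (s (k + Suc n))) sums (B f (\<eta> n) - ?S)"
      by (rule sums_split_initial_segment[OF f_sums])
    then have tail: "norm (B f (\<eta> n) - ?S) \<le> T (\<eta> n) / 4 ^ Suc n * (4 / 3)"
      using geo summand_le by (rule norm_sums_le)
    have "norm ?S \<ge> norm (summand n n 1) / 2"
      using s[of n] by (simp add: P_def)
    moreover have "norm (summand n n 1) \<ge> (9 / 10 * T (\<eta> n)) / 4 ^ n"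
      using divide_right_mono[OF less_imp_le[OF hump[of n]], of "4 ^ n"]
      by (simp add: summand_def norm_mult norm_divide norm_power)
    moreover define q where "q = T (\<eta> n) / 4 ^ n"
    ultimately have "norm ?S \<ge> 9 / 20 * q" by simp
    moreover have "norm ?S \<le> norm (B f (\<eta> n)) + norm (B f (\<eta> n) - ?S)"
      by (metis norm_triangle_sub norm_minus_commute)
    moreover have "norm (B f (\<eta> n) - ?S) \<le> 1 / 3 * q" using tail by (simp add: q_def)
    ultimately have "norm (B f (\<eta> n)) \<ge> 7 / 60 * q" by linarith
    moreover have "q \<ge> 4 ^ n"
      using T_ge[of n] by (simp add: q_def pos_le_divide_eq flip: power_mult_distrib)
    ultimately show ?thesis by linarith
  qed
  have "\<exists>\<eta>\<in>E. norm (B f \<eta>) > M" for M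
  proof -
    obtain n where "60 / 7 * M < 4 ^ n" using real_arch_pow[of 4 "60 / 7 * M"] by auto
    then have "M < norm (B f (\<eta> n))" using large[of n] by simp
    then show ?thesis using \<eta> by blast
  qed
  then show ?thesis using f by blast
qed

section \<open>Smooth functions\<close>

text \<open>
  The derivative of \<open>flat_exp k\<close> is a combination of \<open>flat_exp (k + 1)\<close> and \<open>flat_exp (k + 2)\<close>, at the origin
  as well, where all these functions vanish to infinite order. The family is therefore closed under
  differentiation, and smoothness of everything built from it needs no formula for higher derivatives.
\<close>

definition flat_exp :: "nat \<Rightarrow> real \<Rightarrow> real" where
  "flat_exp k t = (if t > 0 then exp (- 1 / t) / t ^ k else 0)"

lemma flat_tendsto_0: "((\<lambda>t. flat_exp k t) \<longlongrightarrow> 0) (at 0)"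
proof -
  have "((\<lambda>t. inverse t ^ k / exp (inverse t)) \<longlongrightarrow> (0::real)) (at_right 0)"
    by (rule filterlim_compose[OF tendsto_power_div_exp_0 filterlim_inverse_at_top_right])
  moreover have "\<forall>\<^sub>F t in at_right 0. inverse t ^ k / exp (inverse t) = flat_exp k t"
    unfolding eventually_at_right_field
    by (auto simp: flat_exp_def exp_minus field_simps intro!: exI[of _ 1])
  ultimately have "(flat_exp k \<longlongrightarrow> 0) (at_right 0)"
    by (rule Lim_transform_eventually)
  moreover have "(flat_exp k \<longlongrightarrow> 0) (at_left 0)"
    by (rule tendsto_eventually) (auto simp: eventually_at_left_field flat_exp_def intro!: exI[of _ "-1"])
  ultimately show ?thesis by (simp add: filterlim_split_at)
qed

lemma has_derivative_flat:
  "(flat_exp k has_real_derivative flat_exp (k + 2) t - k * flat_exp (k + 1) t) (at t)"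
proof -
  consider "t > 0" | "t < 0" | "t = 0" by linarith
  then show ?thesis
  proof cases
    case 1
    have "((\<lambda>t. exp (- 1 / t) / t ^ k) has_real_derivative flat_exp (k + 2) t - k * flat_exp (k + 1) t) (at t)"
    proof (rule DERIV_cong)
      show "((\<lambda>t. exp (- 1 / t) / t ^ k) has_real_derivative
          (exp (- 1 / t) * (1 / (t * t)) * t ^ k - exp (- 1 / t) * (k * t ^ (k - 1))) / (t ^ k * t ^ k)) (at t)"
        using 1 by (auto intro!: derivative_eq_intros)
      have "k * t ^ (k - 1) = k * t ^ k / t"
        using 1 by (cases k) auto
      then show "(exp (- 1 / t) * (1 / (t * t)) * t ^ k - exp (- 1 / t) * (k * t ^ (k - 1))) / (t ^ k * t ^ k)
          = flat_exp (k + 2) t - k * flat_exp (k + 1) t"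
        using 1 by (auto simp: flat_exp_def field_simps)
    qed
    moreover have ev: "\<forall>\<^sub>F s in nhds t. exp (- 1 / s) / s ^ k = flat_exp k s"
      using 1 by (auto simp: eventually_nhds flat_exp_def intro!: exI[of _ "{0<..}"])
    ultimately show ?thesis using DERIV_cong_ev[OF refl ev refl] by simp
  next
    case 2
    have "((\<lambda>t. 0) has_real_derivative flat_exp (k + 2) t - k * flat_exp (k + 1) t) (at t)"
      using 2 by (simp add: flat_exp_def)
    moreover have ev: "\<forall>\<^sub>F s in nhds t. 0 = flat_exp k s"
      using 2 by (auto simp: eventually_nhds flat_exp_def intro!: exI[of _ "{..<0}"])
    ultimately show ?thesis using DERIV_cong_ev[OF refl ev refl] by simp
  next
    case 3
    \<comment> \<open>The difference quotient at the origin is itself a member of the family.\<close>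
    have "(\<lambda>h. (flat_exp k (0 + h) - flat_exp k 0) / h) = flat_exp (Suc k)"
      by (auto simp: fun_eq_iff flat_exp_def)
    then have "(flat_exp k has_real_derivative 0) (at 0)"
      unfolding DERIV_def using flat_tendsto_0[of "Suc k"] by metis
    then show ?thesis using 3 by (simp add: flat_exp_def)
  qed
qed

text \<open>
  Every test function of the proof lies in this algebra. Its generators have their directional
  derivatives in it, so it is closed under differentiation, and a class of differentiable functions
  with this closure property consists of smooth functions.
\<close>

inductive_set flat_algebra :: "(real ^ 'n::finite \<Rightarrow> complex) set" where
  const: "(\<lambda>x. c) \<in> flat_algebra"
| character: "(\<lambda>x. exp (\<i> * complex_of_real (x \<bullet> \<zeta>))) \<in> flat_algebra"
| flat_exp: "(\<lambda>x. complex_of_real (flat_exp k (a + b * x $ j))) \<in> flat_algebra"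
| add: "f \<in> flat_algebra \<Longrightarrow> g \<in> flat_algebra \<Longrightarrow> (\<lambda>x. f x + g x) \<in> flat_algebra"
| mult: "f \<in> flat_algebra \<Longrightarrow> g \<in> flat_algebra \<Longrightarrow> (\<lambda>x. f x * g x) \<in> flat_algebra"

lemma flat_algebra_derivative:
  assumes "f \<in> flat_algebra"
  shows "\<exists>D. (\<forall>x. (f has_derivative D x) (at x)) \<and> (\<forall>v. (\<lambda>x. D x v) \<in> flat_algebra)"
  using assms
proof induction
  case (const c)
  show ?case
    by (intro exI[of _ "\<lambda>x v. 0"]) (auto intro: flat_algebra.const)
next
  case (character \<zeta>)
  have "((\<lambda>x. exp (\<i> * complex_of_real (x \<bullet> \<zeta>))) has_derivative
      (\<lambda>v. (\<i> * complex_of_real (v \<bullet> \<zeta>)) * exp (\<i> * complex_of_real (x \<bullet> \<zeta>)))) (at x)" for x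
  proof -
    have "((\<lambda>x. \<i> * complex_of_real (x \<bullet> \<zeta>)) has_derivative (\<lambda>v. \<i> * complex_of_real (v \<bullet> \<zeta>))) (at x)"
      by (auto intro!: derivative_eq_intros)
    from has_derivative_compose[OF this DERIV_exp[unfolded has_field_derivative_def]]
    show ?thesis by (simp add: mult.commute)
  qed
  then show ?case
    by (intro exI[of _ "\<lambda>x v. (\<i> * complex_of_real (v \<bullet> \<zeta>)) * exp (\<i> * complex_of_real (x \<bullet> \<zeta>))"])
      (auto intro!: flat_algebra.intros)
next
  case (flat_exp k a b j)
  let ?D = "\<lambda>x v. complex_of_real (b * v $ j) *
    (complex_of_real (flat_exp (k + 2) (a + b * x $ j)) + (- of_nat k) * complex_of_real (flat_exp (k + 1) (a + b * x $ j)))"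
  have "((\<lambda>x. complex_of_real (flat_exp k (a + b * x $ j))) has_derivative ?D x) (at x)" for x
  proof -
    have "((\<lambda>x. a + b * x $ j) has_derivative (\<lambda>v. b * v $ j)) (at x)"
      by (auto intro!: derivative_eq_intros bounded_linear.has_derivative[OF bounded_linear_vec_nth])
    then have "((\<lambda>x. flat_exp k (a + b * x $ j)) has_derivative
        (\<lambda>v. (flat_exp (k + 2) (a + b * x $ j) - k * flat_exp (k + 1) (a + b * x $ j)) * (b * v $ j))) (at x)"
      using has_derivative_compose[OF _ has_derivative_flat[unfolded has_field_derivative_def]] by blast
    from has_derivative_of_real[OF this] show ?thesis
      by (rule has_derivative_eq_rhs) (auto simp: fun_eq_iff algebra_simps)
  qed
  moreover have "(\<lambda>x. ?D x v) \<in> flat_algebra" for v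
    by (intro flat_algebra.mult flat_algebra.add flat_algebra.const flat_algebra.flat_exp)
  ultimately show ?case by (intro exI[of _ ?D]) simp
next
  case (add f g)
  then obtain D D' where
    D: "\<And>x. (f has_derivative D x) (at x)" "\<And>v. (\<lambda>x. D x v) \<in> flat_algebra"
    and D': "\<And>x. (g has_derivative D' x) (at x)" "\<And>v. (\<lambda>x. D' x v) \<in> flat_algebra"
    by blast
  show ?case
    by (intro exI[of _ "\<lambda>x v. D x v + D' x v"] conjI allI has_derivative_add flat_algebra.add D D')
next
  case (mult f g)
  then obtain D D' where
    D: "\<And>x. (f has_derivative D x) (at x)" "\<And>v. (\<lambda>x. D x v) \<in> flat_algebra"
    and D': "\<And>x. (g has_derivative D' x) (at x)" "\<And>v. (\<lambda>x. D' x v) \<in> flat_algebra"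
    by blast
  show ?case
    by (intro exI[of _ "\<lambda>x v. f x * D' x v + D x v * g x"] conjI allI has_derivative_mult
        flat_algebra.add flat_algebra.mult D D' mult.hyps)
qed

lemma partial_deriv_eq:
  assumes "(f has_derivative D) (at x)"
  shows "partial_deriv i f x = D (axis i 1)"
proof -
  have "((\<lambda>t. x + t *\<^sub>R axis i 1) has_derivative (\<lambda>t. t *\<^sub>R axis i 1)) (at 0)"
    by (auto intro!: derivative_eq_intros)
  moreover have "(f has_derivative D) (at (x + 0 *\<^sub>R axis i 1))" using assms by simp
  ultimately have "((\<lambda>t. f (x + t *\<^sub>R axis i 1)) has_derivative (\<lambda>t. D (t *\<^sub>R axis i 1))) (at 0)"
    by (rule has_derivative_compose)
  moreover have "D (t *\<^sub>R axis i 1) = t *\<^sub>R D (axis i 1)" for t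
    using has_derivative_bounded_linear[OF assms] by (simp add: bounded_linear.linear linear_cmul)
  ultimately have "((\<lambda>t. f (x + t *\<^sub>R axis i 1)) has_vector_derivative D (axis i 1)) (at 0)"
    by (simp add: has_vector_derivative_def)
  then show ?thesis unfolding partial_deriv_def by (rule vector_derivative_at)
qed

lemma flat_algebra_iter_deriv: "f \<in> flat_algebra \<Longrightarrow> iter_deriv is f \<in> flat_algebra"
proof (induction "is")
  case Nil
  then show ?case by (simp add: iter_deriv_def)
next
  case (Cons i "is")
  then obtain D where D: "\<And>x. (iter_deriv is f has_derivative D x) (at x)"
    "\<And>v. (\<lambda>x. D x v) \<in> flat_algebra"
    using flat_algebra_derivative[of "iter_deriv is f"] by blast
  have "iter_deriv (i # is) f = (\<lambda>x. D x (axis i 1))"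
    using partial_deriv_eq[OF D(1)] by (auto simp: iter_deriv_def)
  then show ?case using D(2) by simp
qed

lemma flat_algebra_smooth: "f \<in> flat_algebra \<Longrightarrow> smooth f"
  unfolding smooth_def differentiable_def
  using flat_algebra_derivative[OF flat_algebra_iter_deriv] by blast

lemma flat_algebra_continuous: "f \<in> flat_algebra \<Longrightarrow> continuous_on A f"
  using flat_algebra_derivative[of f] has_derivative_continuous
  by (blast intro: continuous_at_imp_continuous_on)

lemma flat_algebra_prod:
  "finite I \<Longrightarrow> (\<And>i. i \<in> I \<Longrightarrow> f i \<in> flat_algebra) \<Longrightarrow> (\<lambda>x. \<Prod>i\<in>I. f i x) \<in> flat_algebra"
  by (induction I rule: finite_induct) (auto intro: flat_algebra.intros)

lemma flat_algebra_sum: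
  "finite I \<Longrightarrow> (\<And>i. i \<in> I \<Longrightarrow> f i \<in> flat_algebra) \<Longrightarrow> (\<lambda>x. \<Sum>i\<in>I. f i x) \<in> flat_algebra"
  by (induction I rule: finite_induct) (auto intro: flat_algebra.intros)

section \<open>Integrals over Euclidean space\<close>

lemma lborel_integral_affine:
  fixes f :: "'a::euclidean_space \<Rightarrow> 'b::{banach, second_countable_topology}"
  assumes [measurable]: "f \<in> borel_measurable borel" and c: "c \<noteq> 0"
  shows lborel_integrable_affine_iff:
      "integrable lborel (\<lambda>x. f (t + c *\<^sub>R x)) \<longleftrightarrow> integrable lborel f"
    and "(LINT x|lborel. f x) = \<bar>c\<bar> ^ DIM('a) *\<^sub>R (LINT x|lborel. f (t + c *\<^sub>R x))"
proof -
  note eq = lborel_affine[OF c, of t]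
  have "integrable lborel f \<longleftrightarrow> integrable lborel (\<lambda>x. \<bar>c\<bar> ^ DIM('a) *\<^sub>R f (t + c *\<^sub>R x))"
    by (subst eq) (simp add: integrable_density integrable_distr_eq)
  also have "\<dots> \<longleftrightarrow> integrable lborel (\<lambda>x. f (t + c *\<^sub>R x))"
    using c integrable_scaleR_right[of "inverse (\<bar>c\<bar> ^ DIM('a))" lborel "\<lambda>x. \<bar>c\<bar> ^ DIM('a) *\<^sub>R f (t + c *\<^sub>R x)"]
    by auto
  finally show "integrable lborel (\<lambda>x. f (t + c *\<^sub>R x)) \<longleftrightarrow> integrable lborel f" ..
  show "(LINT x|lborel. f x) = \<bar>c\<bar> ^ DIM('a) *\<^sub>R (LINT x|lborel. f (t + c *\<^sub>R x))"
    by (subst eq) (simp add: integral_density integral_distr)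
qed

text \<open>
  The double integrals below all have integrands of the form (unimodular phase) times \<open>a(x) b(y)\<close>,
  for which the product \<open>f x * g y\<close> is an integrable majorant.
\<close>

lemma lborel_Fubini_dominated:
  fixes k :: "'a::euclidean_space \<Rightarrow> 'b::euclidean_space \<Rightarrow> complex"
  assumes k[measurable]: "case_prod k \<in> borel_measurable (lborel \<Otimes>\<^sub>M lborel)"
    and f: "integrable lborel f" and g: "integrable lborel g"
    and le: "\<And>x y. norm (k x y) \<le> f x * g y"
  shows "(LINT x|lborel. LINT y|lborel. k x y) = (LINT y|lborel. LINT x|lborel. k x y)"
proof -
  have [measurable]: "f \<in> borel_measurable borel" "g \<in> borel_measurable borel"
    using f g by (simp_all add: borel_measurable_integrable)
  have "integrable (lborel \<Otimes>\<^sub>M lborel) (\<lambda>(x, y). f x * g y)"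
  proof (rule lborel_pair.Fubini_integrable)
    show "integrable lborel (\<lambda>x. LINT y|lborel. norm (case (x, y) of (x, y) \<Rightarrow> f x * g y))"
      using f by (simp add: abs_mult)
  qed (use g in auto)
  then have "integrable (lborel \<Otimes>\<^sub>M lborel) (case_prod k)"
    by (rule Bochner_Integration.integrable_bound) (auto intro: order.trans[OF le abs_ge_self])
  from lborel_pair.Fubini_integral[OF this] show ?thesis by simp
qed

lemma lborel_prod_coordinates:
  fixes g :: "'n::finite \<Rightarrow> real \<Rightarrow> complex"
  assumes g: "\<And>i. integrable lborel (g i)"
  shows lborel_integrable_prod_coordinates:
      "integrable lborel (\<lambda>x::real ^ 'n. \<Prod>i\<in>UNIV. g i (x $ i))" (is "integrable _ ?P")
    and lborel_integral_prod_coordinates: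
      "(LINT x|lborel. (\<Prod>i\<in>UNIV. g i ((x::real ^ 'n) $ i))) = (\<Prod>i\<in>UNIV. LINT t|lborel. g i t)"
proof -
  interpret product_sigma_finite "\<lambda>_::real ^ 'n. lborel :: real measure" ..
  define ix where "ix = inv (\<lambda>i::'n. axis i (1::real))"
  have inj: "inj (\<lambda>i::'n. axis i (1::real))"
    by (auto intro: injI simp: axis_eq_axis)
  have ix: "ix (axis i 1) = i" for i
    using inv_f_f[OF inj, of i] by (simp add: ix_def)
  have Basis: "(Basis :: (real ^ 'n) set) = range (\<lambda>i. axis i 1)"
    by (auto simp: Basis_vec_def)
  have reindex: "(\<Prod>b\<in>(Basis :: (real ^ 'n) set). h b) = (\<Prod>i\<in>UNIV. h (axis i 1))" for h :: "_ \<Rightarrow> complex"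
    unfolding Basis by (subst prod.reindex[OF inj]) simp
  have [measurable]: "g i \<in> borel_measurable borel" for i
    using g[of i] by (simp add: borel_measurable_integrable)
  have P[measurable]: "?P \<in> borel_measurable borel" by measurable
  have eq: "?P (\<Sum>b\<in>Basis. f b *\<^sub>R b) = (\<Prod>b\<in>Basis. g (ix b) (f b))" for f
  proof -
    have "(\<Sum>b\<in>Basis. f b *\<^sub>R b) $ i = f (axis i 1)" for i
      using inner_sum_left_Basis[of "axis i (1::real)" f] by (simp add: inner_axis Basis)
    then show ?thesis unfolding reindex ix by simp
  qed
  have T: "(\<lambda>f. \<Sum>b\<in>(Basis :: (real ^ 'n) set). f b *\<^sub>R b) \<in> Pi\<^sub>M Basis (\<lambda>b. lborel) \<rightarrow>\<^sub>M borel"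
    by measurable
  show "integrable lborel ?P"
    unfolding lborel_eq[where 'a = "real ^ 'n"] integrable_distr_eq[OF T P] eq
    by (rule product_integrable_prod) (auto intro: g)
  have "(LINT x|lborel. ?P x) = (\<Prod>b\<in>Basis. LINT t|lborel. g (ix b) t)"
    unfolding lborel_eq[where 'a = "real ^ 'n"] integral_distr[OF T P] eq
    by (rule product_integral_prod) (auto intro: g)
  then show "(LINT x|lborel. ?P x) = (\<Prod>i\<in>UNIV. LINT t|lborel. g i t)"
    unfolding reindex ix .
qed

section \<open>A bump function on the line and its Fourier transform\<close>

definition bump :: "real \<Rightarrow> real" where
  "bump t = flat_exp 0 (1 - t) * flat_exp 0 (1 + t)"

lemma flat_bounds: "0 \<le> flat_exp 0 t \<and> flat_exp 0 t \<le> 1"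
  by (auto simp: flat_exp_def)

lemma flat_continuous [continuous_intros]: "continuous_on A g \<Longrightarrow> continuous_on A (\<lambda>x. flat_exp k (g x))"
  by (rule continuous_on_compose2[of UNIV "flat_exp k" A g, OF DERIV_continuous_on])
    (auto intro: has_derivative_flat)

lemma bump_bounds: "0 \<le> bump t \<and> bump t \<le> 1"
  using flat_bounds[of "1 - t"] flat_bounds[of "1 + t"] by (auto simp: bump_def intro: mult_le_one)

lemma bump_0: "bump 0 > 0"
  by (simp add: bump_def flat_exp_def)

lemma bump_minus: "bump (- t) = bump t"
  by (simp add: bump_def mult.commute)

lemma bump_eq_0: "\<bar>t\<bar> \<ge> 1 \<Longrightarrow> bump t = 0"
  by (auto simp: bump_def flat_exp_def)

lemma bump_continuous [continuous_intros]: "continuous_on A g \<Longrightarrow> continuous_on A (\<lambda>x. bump (g x))"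
  unfolding bump_def by (intro continuous_intros)

lemma bump_measurable [measurable]: "bump \<in> borel_measurable borel"
  by (intro borel_measurable_continuous_onI continuous_intros)

lemma bump_cong:
  "bump s * x = indicator {-1..1} s *\<^sub>R (bump s * x)"
  by (cases "\<bar>s\<bar> \<ge> 1") (auto simp: indicator_def bump_eq_0)

lemma integrable_bump: "integrable lborel bump"
proof -
  have "set_integrable lborel {-1..1} bump"
    by (intro borel_integrable_atLeastAtMost' continuous_intros)
  moreover have "(\<lambda>s. indicator {-1..1} s *\<^sub>R bump s) = bump"
    using bump_cong[of _ 1] by auto
  ultimately show ?thesis unfolding set_integrable_def by simp
qed

definition bump_transform :: "real \<Rightarrow> complex" where
  "bump_transform t = (LINT s|lborel. exp (\<i> * complex_of_real (t * s)) * complex_of_real (bump s))"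

lemma bump_transform_measurable [measurable]: "bump_transform \<in> borel_measurable borel"
  unfolding bump_transform_def by measurable

lemma integrable_modulated_bump:
  "integrable lborel (\<lambda>s. exp (\<i> * complex_of_real (t * s)) * complex_of_real (bump s))"
  by (rule Bochner_Integration.integrable_bound[OF integrable_bump]) (auto simp: norm_mult)

text \<open>
  Two integrations by parts, done in one step: \<open>e\<^sup>i\<^sup>t\<^sup>s (b' - i t b)\<close> is a primitive of \<open>e\<^sup>i\<^sup>t\<^sup>s (b'' + t\<^sup>2 b)\<close>
  and vanishes at \<open>\<plusminus>1\<close>, so \<open>t\<^sup>2\<close> times the transform of \<open>b\<close> is minus the transform of \<open>b''\<close>.
\<close>

lemma bump_transform_decay: "\<exists>C. \<forall>t. norm (bump_transform t) * (1 + t\<^sup>2) \<le> C"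
proof -
  let ?e = "\<lambda>t s. exp (\<i> * complex_of_real (t * s))"
  let ?I = "indicator {-1..1} :: real \<Rightarrow> real"
  define b1 where "b1 s = flat_exp 0 (1 - s) * flat_exp 2 (1 + s) - flat_exp 2 (1 - s) * flat_exp 0 (1 + s)" for s
  define b2 where "b2 s = flat_exp 0 (1 - s) * (flat_exp 4 (1 + s) - 2 * flat_exp 3 (1 + s))
    - 2 * (flat_exp 2 (1 - s) * flat_exp 2 (1 + s)) + (flat_exp 4 (1 - s) - 2 * flat_exp 3 (1 - s)) * flat_exp 0 (1 + s)" for s
  note d = DERIV_chain2[OF has_derivative_flat]
  have bump': "(bump has_real_derivative b1 s) (at s)" for s
    unfolding bump_def b1_def
    by (auto intro!: derivative_eq_intros d simp: numeral_eq_Suc)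
  have b1': "(b1 has_real_derivative b2 s) (at s)" for s
    unfolding b1_def b2_def
    by (auto intro!: derivative_eq_intros d simp: numeral_eq_Suc algebra_simps)
  have b2_cont: "continuous_on A b2" for A
    unfolding b2_def by (intro continuous_intros)
  have e': "((\<lambda>s. ?e t s) has_vector_derivative \<i> * complex_of_real t * ?e t s) (at s)" for t s
    by (auto intro!: derivative_eq_intros has_vector_derivative_real_field)
  have parts: "t\<^sup>2 *\<^sub>R bump_transform t = - (LINT s|lborel. ?I s *\<^sub>R (?e t s * complex_of_real (b2 s)))" for t
  proof -
    let ?F = "\<lambda>s. ?e t s * (complex_of_real (b1 s) - \<i> * complex_of_real t * complex_of_real (bump s))"
    let ?f = "\<lambda>s. ?e t s * (complex_of_real (b2 s) + complex_of_real (t\<^sup>2) * complex_of_real (bump s))"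
    have "(?F has_vector_derivative ?f s) (at s within {-1..1})" for s
    proof -
      have "((\<lambda>s. complex_of_real (bump s)) has_vector_derivative complex_of_real (b1 s)) (at s)"
        "((\<lambda>s. complex_of_real (b1 s)) has_vector_derivative complex_of_real (b2 s)) (at s)"
        using bump' b1' by (auto intro!: has_vector_derivative_of_real simp: has_real_derivative_iff_has_vector_derivative)
      then have "((\<lambda>s. complex_of_real (b1 s) - \<i> * complex_of_real t * complex_of_real (bump s))
          has_vector_derivative complex_of_real (b2 s) - \<i> * complex_of_real t * complex_of_real (b1 s)) (at s)"
        by (intro has_vector_derivative_diff has_vector_derivative_mult_right)
      from has_vector_derivative_mult[OF e'[of t] this]
      have "(?F has_vector_derivative ?f s) (at s)"
        by (simp add: algebra_simps power2_eq_square)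
      then show ?thesis by (rule has_vector_derivative_at_within)
    qed
    moreover have "continuous_on {-1..1} ?f"
      by (intro continuous_intros b2_cont)
    ultimately have "(LINT s|lborel. ?I s *\<^sub>R ?f s) = ?F 1 - ?F (-1)"
      by (intro integral_FTC_Icc) auto
    also have "\<dots> = 0" by (simp add: bump_def b1_def flat_exp_def)
    finally have "(LINT s|lborel. ?I s *\<^sub>R ?f s) = 0" .
    moreover have "?I s *\<^sub>R ?f s = ?I s *\<^sub>R (?e t s * complex_of_real (b2 s))
        + t\<^sup>2 *\<^sub>R (?e t s * complex_of_real (bump s))" for s
      by (cases "\<bar>s\<bar> \<ge> 1") (auto simp: bump_eq_0 algebra_simps indicator_def scaleR_conv_of_real)
    ultimately have "(LINT s|lborel. ?I s *\<^sub>R (?e t s * complex_of_real (b2 s))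
        + t\<^sup>2 *\<^sub>R (?e t s * complex_of_real (bump s))) = 0"
      by simp
    moreover have "continuous_on {-1..1} (\<lambda>s. ?e t s * complex_of_real (b2 s))"
      by (intro continuous_intros b2_cont)
    then have "integrable lborel (\<lambda>s. ?I s *\<^sub>R (?e t s * complex_of_real (b2 s)))"
      using borel_integrable_atLeastAtMost' unfolding set_integrable_def by blast
    ultimately show ?thesis
      using integrable_modulated_bump[of t]
      by (simp add: bump_transform_def eq_neg_iff_add_eq_0 add.commute)
  qed
  define C where "C = (LINT s|lborel. \<bar>?I s *\<^sub>R b2 s\<bar>)"
  have "norm (bump_transform t) * (1 + t\<^sup>2) \<le> (LINT s|lborel. bump s) + C" for t
  proof -
    have "norm (bump_transform t) \<le> (LINT s|lborel. norm (?e t s * complex_of_real (bump s)))"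
      unfolding bump_transform_def by (rule integral_norm_bound)
    also have "\<dots> = (LINT s|lborel. bump s)"
      using bump_bounds by (simp add: norm_mult)
    finally have 1: "norm (bump_transform t) \<le> (LINT s|lborel. bump s)" .
    have "t\<^sup>2 * norm (bump_transform t) = norm (t\<^sup>2 *\<^sub>R bump_transform t)" by simp
    also have "\<dots> \<le> (LINT s|lborel. norm (?I s *\<^sub>R (?e t s * complex_of_real (b2 s))))"
      unfolding parts norm_minus_cancel by (rule integral_norm_bound)
    also have "\<dots> = C" by (simp add: C_def norm_mult abs_mult)
    finally show ?thesis using 1 by (simp add: algebra_simps)
  qed
  then show ?thesis by blast
qed

lemma integrable_bump_transform: "integrable lborel bump_transform"
proof -
  obtain C where C: "\<And>t. norm (bump_transform t) * (1 + t\<^sup>2) \<le> C"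
    using bump_transform_decay by blast
  have "integrable lborel (\<lambda>t::real. C * inverse (1 + t\<^sup>2))"
    using integrable_inverse_1_plus_square by (simp add: set_integrable_def)
  then show ?thesis
  proof (rule Bochner_Integration.integrable_bound)
    have "norm (bump_transform t) \<le> norm (C * inverse (1 + t\<^sup>2))" for t
    proof -
      have pos: "1 + t\<^sup>2 > 0" by (simp add: add_pos_nonneg)
      have "0 \<le> norm (bump_transform t) * (1 + t\<^sup>2)" by simp
      then have "C \<ge> 0" using C[of t] by linarith
      then show ?thesis using C[of t] pos by (simp add: field_simps abs_mult)
    qed
    then show "AE t in lborel. norm (bump_transform t) \<le> norm (C * inverse (1 + t\<^sup>2))" by simp
  qed measurable
qed

text \<open>
  Fourier inversion at the origin. Integrating against a Gaussian of width \<open>m\<close> and exchanging the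
  integrals turns the left side into an average of \<open>bump\<close> over a Gaussian of width \<open>1/m\<close>, because the
  characteristic function of the normal distribution is again Gaussian; then \<open>m \<rightarrow> \<infinity>\<close>.
\<close>

lemma integral_bump_transform: "(LINT t|lborel. bump_transform t) = complex_of_real (2 * pi * bump 0)"
proof -
  let ?N = std_normal_density
  let ?e = "\<lambda>t s. exp (\<i> * complex_of_real (t * s))"
  have N_int: "integrable lborel ?N" by (rule integrable_normal_density) simp
  have N_le: "?N t \<le> ?N 0" for t
    by (simp add: std_normal_density_def divide_right_mono)
  have char: "(LINT t|lborel. ?N t *\<^sub>R ?e t s) = complex_of_real (sqrt (2 * pi) * ?N s)" for s
  proof -
    have "(LINT t|lborel. ?N t *\<^sub>R ?e t s) = char std_normal_distribution s"
      unfolding char_def by (subst integral_density) (auto simp: mult_ac)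
    also have "\<dots> = complex_of_real (exp (- (s\<^sup>2) / 2))"
      unfolding char_std_normal_distribution ..
    finally show ?thesis by (simp add: std_normal_density_def)
  qed
  have eq: "(LINT t|lborel. ?N (t / m) *\<^sub>R bump_transform t)
      = complex_of_real (sqrt (2 * pi)) * (LINT v|lborel. ?N v *\<^sub>R complex_of_real (bump (v / m)))"
    if m: "m > 0" for m :: real
  proof -
    have Nm: "integrable lborel (\<lambda>t. ?N (t / m))"
      using lborel_integrable_affine_iff[of ?N "1 / m" 0] N_int m by simp
    have "(LINT t|lborel. ?N (t / m) *\<^sub>R bump_transform t)
        = (LINT t|lborel. LINT s|lborel. ?N (t / m) *\<^sub>R (?e t s * complex_of_real (bump s)))"
      by (simp add: bump_transform_def)
    also have "\<dots> = (LINT s|lborel. LINT t|lborel. ?N (t / m) *\<^sub>R (?e t s * complex_of_real (bump s)))"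
      by (rule lborel_Fubini_dominated[OF _ Nm integrable_bump])
        (use bump_bounds in \<open>auto simp: norm_mult\<close>)
    also have "\<dots> = (LINT s|lborel. m * (complex_of_real (sqrt (2 * pi) * ?N (m * s))) * complex_of_real (bump s))"
    proof (rule Bochner_Integration.integral_cong[OF refl])
      fix s
      have "(LINT t|lborel. ?N (t / m) *\<^sub>R (?e t s * complex_of_real (bump s)))
          = (LINT t|lborel. ?N (t / m) *\<^sub>R ?e t s) * complex_of_real (bump s)"
        by (simp add: mult.assoc[symmetric] flip: integral_mult_left_zero)
      also have "(LINT t|lborel. ?N (t / m) *\<^sub>R ?e t s) = m *\<^sub>R (LINT v|lborel. ?N v *\<^sub>R ?e v (m * s))"
        using m by (subst lborel_integral_affine(2)[where c = m and t = 0]) (auto simp: mult_ac)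
      finally show "(LINT t|lborel. ?N (t / m) *\<^sub>R (?e t s * complex_of_real (bump s)))
          = m * (complex_of_real (sqrt (2 * pi) * ?N (m * s))) * complex_of_real (bump s)"
        unfolding char by (simp add: scaleR_conv_of_real)
    qed
    also have "\<dots> = complex_of_real (sqrt (2 * pi)) * (m *\<^sub>R (LINT s|lborel. ?N (m * s) *\<^sub>R complex_of_real (bump s)))"
      by (simp add: scaleR_conv_of_real mult_ac flip: integral_mult_right_zero)
    also have "m *\<^sub>R (LINT s|lborel. ?N (m * s) *\<^sub>R complex_of_real (bump s))
        = (LINT v|lborel. ?N v *\<^sub>R complex_of_real (bump (v / m)))"
      using m by (subst lborel_integral_affine(2)[where c = m and t = 0]) auto
    finally show ?thesis .
  qed
  have "(\<lambda>m. LINT t|lborel. ?N (t / Suc m) *\<^sub>R bump_transform t)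
      \<longlonglongrightarrow> (LINT t|lborel. ?N 0 *\<^sub>R bump_transform t)"
  proof (rule integral_dominated_convergence[where w = "\<lambda>t. ?N 0 * norm (bump_transform t)"])
    show "AE t in lborel. (\<lambda>m. ?N (t / Suc m) *\<^sub>R bump_transform t) \<longlonglongrightarrow> ?N 0 *\<^sub>R bump_transform t"
    proof (intro AE_I2 tendsto_scaleR tendsto_const)
      fix t :: real
      have "(\<lambda>m. t / real (Suc m)) \<longlonglongrightarrow> 0"
        by (rule LIMSEQ_Suc[OF lim_const_over_n])
      moreover have "isCont ?N 0"
        unfolding std_normal_density_def by (intro continuous_intros) auto
      ultimately show "(\<lambda>m. ?N (t / Suc m)) \<longlonglongrightarrow> ?N 0"
        by (rule isCont_tendsto_compose[rotated])
    qed
  qed (use integrable_bump_transform N_le in \<open>auto intro!: mult_right_mono\<close>)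
  moreover have "(\<lambda>m. LINT v|lborel. ?N v *\<^sub>R complex_of_real (bump (v / Suc m)))
      \<longlonglongrightarrow> (LINT v|lborel. ?N v *\<^sub>R complex_of_real (bump 0))"
  proof (rule integral_dominated_convergence[where w = ?N])
    show "AE v in lborel. (\<lambda>m. ?N v *\<^sub>R complex_of_real (bump (v / Suc m))) \<longlonglongrightarrow> ?N v *\<^sub>R complex_of_real (bump 0)"
    proof (intro AE_I2 tendsto_scaleR tendsto_const tendsto_of_real)
      fix v :: real
      have "(\<lambda>m. v / real (Suc m)) \<longlonglongrightarrow> 0"
        by (rule LIMSEQ_Suc[OF lim_const_over_n])
      moreover have "isCont bump 0"
        using bump_continuous[OF continuous_on_id, of UNIV] by (simp add: continuous_on_eq_continuous_at)
      ultimately show "(\<lambda>m. bump (v / Suc m)) \<longlonglongrightarrow> bump 0"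
        by (rule isCont_tendsto_compose[rotated])
    qed
  qed (use N_int bump_bounds in \<open>auto intro!: mult_left_le\<close>)
  ultimately have "(LINT t|lborel. ?N 0 *\<^sub>R bump_transform t)
      = complex_of_real (sqrt (2 * pi)) * (LINT v|lborel. ?N v *\<^sub>R complex_of_real (bump 0))"
    using eq[of "Suc _"] by (auto intro: LIMSEQ_unique tendsto_mult)
  moreover have "(LINT v|lborel. ?N v *\<^sub>R complex_of_real (bump 0)) = complex_of_real (bump 0)"
    using integral_normal_density[of 1 0] by (simp add: N_int)
  ultimately have "?N 0 *\<^sub>R (LINT t|lborel. bump_transform t) = complex_of_real (sqrt (2 * pi) * bump 0)"
    by (simp only: integral_scaleR_right of_real_mult)
  moreover have "?N 0 = 1 / sqrt (2 * pi)" by (simp add: std_normal_density_def)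
  ultimately have "(1 / sqrt (2 * pi)) *\<^sub>R (LINT t|lborel. bump_transform t)
      = complex_of_real (sqrt (2 * pi) * bump 0)"
    by (simp only:)
  then have "(sqrt (2 * pi) * (1 / sqrt (2 * pi))) *\<^sub>R (LINT t|lborel. bump_transform t)
      = complex_of_real (sqrt (2 * pi) * (sqrt (2 * pi) * bump 0))"
    by (simp only: mult.assoc scaleR_conv_of_real of_real_mult)
  moreover have "sqrt (2 * pi) * (1 / sqrt (2 * pi)) = 1" "sqrt (2 * pi) * (sqrt (2 * pi) * bump 0) = 2 * pi * bump 0"
    by (simp_all flip: mult.assoc)
  ultimately show ?thesis by (simp only: scaleR_one)
qed

section \<open>Fourier transforms of cutoffs and of approximate identities\<close>

lemma fourier_lborel:
  fixes f :: "real ^ 'n \<Rightarrow> complex"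
  assumes [measurable]: "f \<in> borel_measurable borel"
  shows "fourier f \<xi> = (LINT x|lborel. exp (- \<i> * complex_of_real (x \<bullet> \<xi>)) * f x)"
  unfolding fourier_def by (rule integral_completion) measurable

lemma inv_fourier_lborel:
  fixes f :: "real ^ 'n \<Rightarrow> complex"
  assumes [measurable]: "f \<in> borel_measurable borel"
  shows "inv_fourier f \<xi> = (LINT x|lborel. exp (\<i> * complex_of_real (\<xi> \<bullet> x)) * f x)
      / complex_of_real ((2 * pi) ^ CARD('n))"
  unfolding inv_fourier_def by (subst integral_completion) simp_all

lemma fourier_conv_inv_fourier:
  "fourier f \<xi> = complex_of_real ((2 * pi) ^ CARD('n)) * inv_fourier f (- \<xi>)"
  for f :: "real ^ 'n \<Rightarrow> complex"
  by (simp add: fourier_def inv_fourier_def inner_commute)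

lemma inv_fourier_measurable [measurable]:
  fixes f :: "real ^ 'n \<Rightarrow> complex"
  assumes [measurable]: "f \<in> borel_measurable borel"
  shows "inv_fourier f \<in> borel_measurable borel"
  unfolding inv_fourier_lborel[OF assms, abs_def] by measurable

lemma fourier_measurable [measurable]:
  fixes f :: "real ^ 'n \<Rightarrow> complex"
  assumes [measurable]: "f \<in> borel_measurable borel"
  shows "fourier f \<in> borel_measurable borel"
  unfolding fourier_lborel[OF assms, abs_def] by measurable

lemma norm_fourier_le:
  fixes f :: "real ^ 'n \<Rightarrow> complex"
  assumes "f \<in> borel_measurable borel"
  shows "norm (fourier f \<xi>) \<le> (LINT x|lborel. norm (f x))"
proof -
  have "norm (fourier f \<xi>) \<le> (LINT x|lborel. norm (exp (- \<i> * complex_of_real (x \<bullet> \<xi>)) * f x))"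
    unfolding fourier_lborel[OF assms] by (rule integral_norm_bound)
  also have "\<dots> = (LINT x|lborel. norm (f x))" by (simp add: norm_mult)
  finally show ?thesis .
qed

text \<open>
  The product structure reduces integrability and the total integral of the Fourier transform of this
  cutoff to the one-dimensional case.
\<close>

definition cutoff :: "real ^ 'n \<Rightarrow> complex" where
  "cutoff x = complex_of_real (\<Prod>i\<in>UNIV. bump (x $ i))"

lemma cutoff_alt: "cutoff x = (\<Prod>i\<in>UNIV. complex_of_real (bump (x $ i)))"
  by (simp add: cutoff_def)

lemma cutoff_flat_algebra: "(\<lambda>x. cutoff (a *\<^sub>R x)) \<in> flat_algebra"
proof -
  have "(\<lambda>x. \<Prod>i\<in>UNIV. complex_of_real (flat_exp 0 (1 + (- a) * x $ i)) *
      complex_of_real (flat_exp 0 (1 + a * x $ i))) \<in> flat_algebra"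
    by (intro flat_algebra_prod flat_algebra.mult flat_algebra.flat_exp) auto
  then show ?thesis by (simp add: cutoff_def bump_def)
qed

lemma cutoff_measurable [measurable]: "cutoff \<in> borel_measurable borel"
  using flat_algebra_continuous[OF cutoff_flat_algebra[of 1], of UNIV]
  by (intro borel_measurable_continuous_onI) simp

lemma norm_cutoff_le: "norm (cutoff x) \<le> 1"
  using bump_bounds by (auto simp: cutoff_alt prod_norm[symmetric] intro!: prod_le_1)

lemma norm_cutoff: "complex_of_real (norm (cutoff x)) = cutoff x"
  using bump_bounds by (simp add: cutoff_alt prod_norm[symmetric])

lemma cutoff_minus: "cutoff (- x) = cutoff x"
  by (simp add: cutoff_def bump_minus)

lemma cutoff_eq_0: "\<bar>x $ i\<bar> \<ge> 1 \<Longrightarrow> cutoff x = 0"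
  using bump_eq_0[of "x $ i"] by (auto simp: cutoff_def)

lemma bump_transform_tendsto:
  assumes "X \<longlonglongrightarrow> t"
  shows "(\<lambda>n. bump_transform (X n)) \<longlonglongrightarrow> bump_transform t"
  unfolding bump_transform_def
proof (rule integral_dominated_convergence[where w = bump])
  show "AE s in lborel. (\<lambda>n. exp (\<i> * complex_of_real (X n * s)) * complex_of_real (bump s))
      \<longlonglongrightarrow> exp (\<i> * complex_of_real (t * s)) * complex_of_real (bump s)"
    by (intro AE_I2 tendsto_intros assms)
qed (use integrable_bump bump_bounds in \<open>auto simp: norm_mult\<close>)

text \<open>
  The absolute value of the transform is at most the integral of \<open>bump\<close>. If the latter were zero, the transform
  would vanish identically, against the inversion formula.
\<close>

lemma integral_bump_pos: "(LINT t|lborel. bump t) > 0"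
proof (rule ccontr)
  assume "\<not> ?thesis"
  moreover have "norm (bump_transform t) \<le> (LINT s|lborel. bump s)" for t
  proof -
    have "norm (bump_transform t)
        \<le> (LINT s|lborel. norm (exp (\<i> * complex_of_real (t * s)) * complex_of_real (bump s)))"
      unfolding bump_transform_def by (rule integral_norm_bound)
    then show ?thesis using bump_bounds by (simp add: norm_mult)
  qed
  ultimately have "norm (bump_transform t) \<le> 0" for t
    by (metis linorder_not_less order.trans)
  then have "bump_transform t = 0" for t by simp
  then have "(LINT t|lborel. bump_transform t) = 0" by simp
  then show False using integral_bump_transform bump_0 by simp
qed

lemma inv_fourier_cutoff:
  "inv_fourier cutoff \<xi> = (\<Prod>i\<in>UNIV. bump_transform (\<xi> $ i) / complex_of_real (2 * pi))"
  for \<xi> :: "real ^ 'n"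
proof -
  have "exp (\<i> * complex_of_real (\<xi> \<bullet> x)) * cutoff x
      = (\<Prod>i\<in>UNIV. exp (\<i> * complex_of_real (\<xi> $ i * x $ i)) * complex_of_real (bump (x $ i)))" for x :: "real ^ 'n"
    by (simp add: cutoff_alt inner_vec_def sum_distrib_left exp_sum prod.distrib)
  then have "(LINT x|lborel. exp (\<i> * complex_of_real (\<xi> \<bullet> x)) * cutoff x) = (\<Prod>i\<in>UNIV. bump_transform (\<xi> $ i))"
    using lborel_integral_prod_coordinates[OF integrable_modulated_bump, of "\<lambda>i. \<xi> $ i"]
    by (simp add: bump_transform_def)
  then show ?thesis by (simp add: inv_fourier_lborel prod_dividef)
qed

lemma integrable_inv_fourier_cutoff:
  "integrable lborel (inv_fourier cutoff :: real ^ 'n \<Rightarrow> complex)"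
  unfolding inv_fourier_cutoff[abs_def]
  by (rule lborel_integrable_prod_coordinates) (simp add: integrable_bump_transform)

lemma integral_inv_fourier_cutoff:
  "(LINT \<xi>|lborel. inv_fourier cutoff (\<xi> :: real ^ 'n)) = complex_of_real (bump 0 ^ CARD('n))"
  unfolding inv_fourier_cutoff
  by (subst lborel_integral_prod_coordinates)
    (simp_all add: integrable_bump_transform integral_bump_transform)

text \<open>
  Realness, a consequence of the evenness of the cutoff, makes it possible to take the real or
  imaginary part of \<open>\<integral> \<psi> \<cdot> inv_fourier \<eta>\<close> under the integral sign, on \<open>\<psi>\<close> alone.
\<close>

lemma inv_fourier_cutoff_real: "inv_fourier cutoff \<xi> \<in> \<real>"
  for \<xi> :: "real ^ 'n"
proof -
  let ?f = "\<lambda>x. exp (\<i> * complex_of_real (\<xi> \<bullet> x)) * cutoff x"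
  have "cnj (LINT x|lborel. ?f x) = (LINT x|lborel. cnj (?f x))"
    by (rule Bochner_Integration.integral_cnj[symmetric])
  also have "\<dots> = (LINT x|lborel. ?f (- x))"
    by (simp add: cutoff_minus exp_cnj) (simp add: cutoff_def)
  also have "\<dots> = (LINT x|lborel. ?f x)"
    by (subst (2) lborel_integral_affine(2)[where c = "-1" and t = 0]) auto
  finally have "(LINT x|lborel. ?f x) \<in> \<real>" by (simp add: complex_is_Real_iff complex_eq_iff)
  then show ?thesis by (simp add: inv_fourier_lborel)
qed

lemma inv_fourier_cutoff_tendsto:
  assumes "X \<longlonglongrightarrow> \<xi>"
  shows "(\<lambda>n. inv_fourier cutoff (X n)) \<longlonglongrightarrow> inv_fourier cutoff \<xi>"
  unfolding inv_fourier_cutoff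
  by (intro tendsto_prod tendsto_divide tendsto_const bump_transform_tendsto tendsto_vec_nth assms) auto

lemma inv_fourier_modulated_cutoff:
  fixes \<zeta> \<xi> :: "real ^ 'n"
  assumes a: "a > 0"
  shows "inv_fourier (\<lambda>x. exp (\<i> * complex_of_real (x \<bullet> (- \<zeta>))) * cutoff (a *\<^sub>R x)) \<xi>
    = inv_fourier cutoff ((1 / a) *\<^sub>R (\<xi> - \<zeta>)) / complex_of_real (a ^ CARD('n))"
proof -
  have eq: "exp (\<i> * complex_of_real (\<xi> \<bullet> x)) * (exp (\<i> * complex_of_real (x \<bullet> (- \<zeta>))) * cutoff (a *\<^sub>R x))
      = exp (\<i> * complex_of_real ((1 / a) *\<^sub>R (\<xi> - \<zeta>) \<bullet> (0 + a *\<^sub>R x))) * cutoff (0 + a *\<^sub>R x)" for x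
  proof -
    have "\<i> * complex_of_real (\<xi> \<bullet> x) + \<i> * complex_of_real (x \<bullet> (- \<zeta>))
        = \<i> * complex_of_real ((1 / a) *\<^sub>R (\<xi> - \<zeta>) \<bullet> (0 + a *\<^sub>R x))"
      using a by (simp add: inner_diff_left inner_commute[of x \<zeta>] right_diff_distrib)
    then show ?thesis by (simp only: mult.assoc[symmetric] exp_add[symmetric]) simp
  qed
  have "(LINT y|lborel. exp (\<i> * complex_of_real ((1 / a) *\<^sub>R (\<xi> - \<zeta>) \<bullet> y)) * cutoff y)
    = a ^ CARD('n) *\<^sub>R (LINT x|lborel. exp (\<i> * complex_of_real (\<xi> \<bullet> x)) *
        (exp (\<i> * complex_of_real (x \<bullet> (- \<zeta>))) * cutoff (a *\<^sub>R x)))"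
    unfolding eq using a by (subst lborel_integral_affine(2)[where c = a and t = 0]) simp_all
  then show ?thesis
    using a unfolding scaleR_conv_of_real[where 'a = complex] by (simp add: inv_fourier_lborel)
qed

text \<open>
  An approximate identity as \<open>m \<rightarrow> \<infinity>\<close>. It plays both roles in the pairing: as an \<open>L\<^sup>1\<close> density approximating
  the point mass, and as a test function with \<open>L\<^sup>1\<close> norm one.
\<close>

definition mollifier :: "real \<Rightarrow> real ^ 'n \<Rightarrow> complex" where
  "mollifier m x = complex_of_real (m ^ CARD('n) / (LINT t|lborel. bump t) ^ CARD('n)) * cutoff (m *\<^sub>R x)"

lemma integral_cutoff:
  "(LINT x|lborel. cutoff (x :: real ^ 'n)) = complex_of_real ((LINT t|lborel. bump t) ^ CARD('n))"
  unfolding cutoff_alt by (subst lborel_integral_prod_coordinates) (simp_all add: integrable_bump)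

lemma mollifier_flat_algebra: "mollifier m \<in> flat_algebra"
  unfolding mollifier_def[abs_def] by (intro flat_algebra.mult flat_algebra.const cutoff_flat_algebra)

lemma mollifier_eq_0:
  assumes "m \<ge> 1" "\<bar>x $ i\<bar> > 1"
  shows "mollifier m x = 0"
proof -
  have "1 * 1 \<le> m * \<bar>x $ i\<bar>" using assms by (intro mult_mono) auto
  then have "cutoff (m *\<^sub>R x) = 0" using assms by (intro cutoff_eq_0[of _ i]) (simp add: abs_mult)
  then show ?thesis by (simp add: mollifier_def)
qed

lemma integral_norm_mollifier:
  assumes m: "m > 0"
  shows "(LINT x|lborel. norm (mollifier m (x :: real ^ 'n))) = 1"
proof -
  let ?I = "(LINT t|lborel. bump t) ^ CARD('n)"
  have I: "?I > 0" using integral_bump_pos by simp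
  have "complex_of_real (LINT x|lborel. norm (cutoff (x :: real ^ 'n))) = (LINT x|lborel. cutoff (x :: real ^ 'n))"
    by (simp only: integral_complex_of_real[symmetric] norm_cutoff)
  then have "(LINT x|lborel. norm (cutoff (x :: real ^ 'n))) = ?I"
    unfolding integral_cutoff of_real_eq_iff .
  moreover have "(LINT x|lborel. norm (cutoff (x :: real ^ 'n)))
      = m ^ CARD('n) * (LINT x|lborel. norm (cutoff (m *\<^sub>R x :: real ^ 'n)))"
    using m by (subst lborel_integral_affine(2)[where c = m and t = 0]) auto
  ultimately show ?thesis
    using m I integral_bump_pos by (simp add: mollifier_def norm_mult norm_divide norm_power)
qed

lemma inv_fourier_mollifier:
  fixes \<xi> :: "real ^ 'n"
  assumes m: "m > 0"
  shows "inv_fourier (mollifier m) \<xi>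
    = inv_fourier cutoff ((1 / m) *\<^sub>R \<xi>) / complex_of_real ((LINT t|lborel. bump t) ^ CARD('n))"
proof -
  have "inv_fourier (mollifier m) \<xi>
      = complex_of_real (m ^ CARD('n) / (LINT t|lborel. bump t) ^ CARD('n)) * inv_fourier (\<lambda>x. cutoff (m *\<^sub>R x)) \<xi>"
    by (simp add: inv_fourier_def mollifier_def mult.left_commute flip: integral_mult_right_zero)
  also have "inv_fourier (\<lambda>x. cutoff (m *\<^sub>R x)) \<xi> = inv_fourier cutoff ((1 / m) *\<^sub>R \<xi>) / complex_of_real (m ^ CARD('n))"
    using inv_fourier_modulated_cutoff[OF m, of 0] by simp
  finally show ?thesis using m by simp
qed

lemma integrable_inv_fourier_mollifier:
  assumes m: "m > 0"
  shows "integrable lborel (inv_fourier (mollifier m) :: real ^ 'n \<Rightarrow> complex)"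
  using lborel_integrable_affine_iff[of "inv_fourier cutoff :: real ^ 'n \<Rightarrow> complex" "1 / m" 0]
    integrable_inv_fourier_cutoff m
  by (auto simp: inv_fourier_mollifier[OF m, abs_def] intro: integrable_divide_zero)

lemma fourier_mollifier_tendsto:
  fixes \<xi> :: "real ^ 'n"
  shows "(\<lambda>m. inv_fourier (mollifier (Suc m)) \<xi>) \<longlonglongrightarrow> 1 / complex_of_real ((2 * pi) ^ CARD('n))"
    and "(\<lambda>m. fourier (mollifier (Suc m)) \<xi>) \<longlonglongrightarrow> 1"
proof -
  have lim: "(\<lambda>m. inv_fourier (mollifier (Suc m)) \<xi>) \<longlonglongrightarrow> 1 / complex_of_real ((2 * pi) ^ CARD('n))"
    for \<xi> :: "real ^ 'n"
  proof -
    have "(\<lambda>m. (1 / real (Suc m)) *\<^sub>R \<xi>) \<longlonglongrightarrow> 0 *\<^sub>R \<xi>"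
      by (intro tendsto_scaleR LIMSEQ_Suc[OF lim_const_over_n] tendsto_const)
    then have "(\<lambda>m. inv_fourier cutoff ((1 / real (Suc m)) *\<^sub>R \<xi>)) \<longlonglongrightarrow> inv_fourier cutoff (0 :: real ^ 'n)"
      by (intro inv_fourier_cutoff_tendsto) simp
    moreover have "inv_fourier cutoff (0 :: real ^ 'n)
        = complex_of_real ((LINT t|lborel. bump t) ^ CARD('n)) / complex_of_real ((2 * pi) ^ CARD('n))"
      by (simp add: inv_fourier_lborel integral_cutoff)
    ultimately have "(\<lambda>m. inv_fourier cutoff ((1 / real (Suc m)) *\<^sub>R \<xi>) / complex_of_real ((LINT t|lborel. bump t) ^ CARD('n)))
        \<longlonglongrightarrow> complex_of_real ((LINT t|lborel. bump t) ^ CARD('n)) / complex_of_real ((2 * pi) ^ CARD('n))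
          / complex_of_real ((LINT t|lborel. bump t) ^ CARD('n))"
      using integral_bump_pos by (intro tendsto_divide tendsto_const) auto
    then show ?thesis using integral_bump_pos by (simp add: inv_fourier_mollifier)
  qed
  show "(\<lambda>m. inv_fourier (mollifier (Suc m)) \<xi>) \<longlonglongrightarrow> 1 / complex_of_real ((2 * pi) ^ CARD('n))" by (rule lim)
  have "(\<lambda>m. complex_of_real ((2 * pi) ^ CARD('n)) * inv_fourier (mollifier (Suc m)) (- \<xi>))
      \<longlonglongrightarrow> complex_of_real ((2 * pi) ^ CARD('n)) * (1 / complex_of_real ((2 * pi) ^ CARD('n)))"
    by (intro tendsto_mult tendsto_const lim)
  then show "(\<lambda>m. fourier (mollifier (Suc m)) \<xi>) \<longlonglongrightarrow> 1"
    by (simp add: fourier_conv_inv_fourier)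
qed

lemma norm_fourier_mollifier_le:
  fixes \<xi> :: "real ^ 'n"
  assumes m: "m > 0"
  shows "norm (fourier (mollifier m) \<xi>) \<le> 1"
    and "norm (inv_fourier (mollifier m) \<xi>) \<le> 1 / (2 * pi) ^ CARD('n)"
proof -
  have [measurable]: "mollifier m \<in> borel_measurable (borel :: (real ^ 'n) measure)"
    by (intro borel_measurable_continuous_onI flat_algebra_continuous mollifier_flat_algebra)
  have le: "norm (fourier (mollifier m) \<xi>) \<le> 1" for \<xi> :: "real ^ 'n"
    using norm_fourier_le[of "mollifier m" \<xi>] integral_norm_mollifier[OF m, where 'n = 'n] by simp
  show "norm (fourier (mollifier m) \<xi>) \<le> 1" by (rule le)
  show "norm (inv_fourier (mollifier m) \<xi>) \<le> 1 / (2 * pi) ^ CARD('n)"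
    using le[of "- \<xi>"] by (simp add: fourier_conv_inv_fourier norm_mult norm_power field_simps)
qed

section \<open>The multiplier as a bilinear pairing\<close>

lemma borel_imp_lebesgue_measurable:
  "f \<in> borel_measurable borel \<Longrightarrow> f \<in> borel_measurable lebesgue"
  by (rule measurable_completion) simp

lemma psi_D_dist_of_space_side:
  fixes \<psi> \<eta> u :: "real ^ 'n \<Rightarrow> complex"
  assumes [measurable]: "\<psi> \<in> borel_measurable borel" "u \<in> borel_measurable borel" "\<eta> \<in> borel_measurable borel"
  shows "psi_D \<psi> (dist_of u) \<eta> = (LINT x|lborel. u x * fourier (\<lambda>\<xi>. \<psi> \<xi> * inv_fourier \<eta> \<xi>) x)"
  unfolding psi_D_def dist_inv_fourier_def dist_mult_def dist_fourier_def dist_of_def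
  by (rule integral_completion) measurable

lemma integrable_symbol_mult:
  fixes \<psi> v :: "real ^ 'n \<Rightarrow> complex"
  assumes "\<psi> \<in> borel_measurable borel" "\<And>\<xi>. norm (\<psi> \<xi>) \<le> C" "integrable lborel v"
  shows "integrable lborel (\<lambda>\<xi>. \<psi> \<xi> * v \<xi>)"
proof (rule Bochner_Integration.integrable_bound)
  show "integrable lborel (\<lambda>\<xi>. C * norm (v \<xi>))" using assms by simp
  show "(\<lambda>\<xi>. \<psi> \<xi> * v \<xi>) \<in> borel_measurable lborel"
    using assms by (intro borel_measurable_times) (auto intro: borel_measurable_integrable)
  show "AE \<xi> in lborel. norm (\<psi> \<xi> * v \<xi>) \<le> norm (C * norm (v \<xi>))"
    unfolding norm_mult using assms(2) by (intro AE_I2) (simp add: abs_mult mult_right_mono order.trans[OF assms(2) abs_ge_self])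
qed

lemma inv_fourier_linear:
  fixes f g :: "real ^ 'n \<Rightarrow> complex"
  shows inv_fourier_cmult: "inv_fourier (\<lambda>x. c * f x) \<xi> = c * inv_fourier f \<xi>"
    and inv_fourier_diff: "integrable lborel f \<Longrightarrow> integrable lborel g \<Longrightarrow>
      inv_fourier (\<lambda>x. f x - g x) \<xi> = inv_fourier f \<xi> - inv_fourier g \<xi>"
proof -
  show "inv_fourier (\<lambda>x. c * f x) \<xi> = c * inv_fourier f \<xi>"
    by (simp add: inv_fourier_def mult.left_commute[of _ c])
  assume f: "integrable lborel f" and g: "integrable lborel g"
  then have [measurable]: "f \<in> borel_measurable borel" "g \<in> borel_measurable borel"
    by (simp_all add: borel_measurable_integrable)
  have int: "integrable lborel (\<lambda>x. exp (\<i> * complex_of_real (\<xi> \<bullet> x)) * f x)"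
    if "integrable lborel f" for f :: "real ^ 'n \<Rightarrow> complex"
    using integrable_symbol_mult[OF _ _ that, of "\<lambda>x. exp (\<i> * complex_of_real (\<xi> \<bullet> x))" 1] by simp
  show "inv_fourier (\<lambda>x. f x - g x) \<xi> = inv_fourier f \<xi> - inv_fourier g \<xi>"
    using int[OF f] int[OF g] by (simp add: inv_fourier_lborel right_diff_distrib diff_divide_distrib)
qed

lemma inv_fourier_sum:
  fixes f :: "'i \<Rightarrow> real ^ 'n \<Rightarrow> complex"
  assumes f: "\<And>i. i \<in> I \<Longrightarrow> integrable lborel (f i)"
  shows "inv_fourier (\<lambda>x. \<Sum>i\<in>I. f i x) \<xi> = (\<Sum>i\<in>I. inv_fourier (f i) \<xi>)"
proof -
  have m: "f i \<in> borel_measurable borel" if "i \<in> I" for i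
    using f[OF that] by (simp add: borel_measurable_integrable)
  have int: "integrable lborel (\<lambda>x. exp (\<i> * complex_of_real (\<xi> \<bullet> x)) * f i x)" if "i \<in> I" for i
    using integrable_symbol_mult[OF _ _ f[OF that], of "\<lambda>x. exp (\<i> * complex_of_real (\<xi> \<bullet> x))" 1] by simp
  have "(\<lambda>x. \<Sum>i\<in>I. f i x) \<in> borel_measurable borel" using m by (rule borel_measurable_sum)
  then show ?thesis
    using int m by (simp add: inv_fourier_lborel sum_distrib_left sum_divide_distrib integral_sum)
qed

text \<open>
  Parseval's identity for the multiplier. This form is symmetric in \<open>u\<close> and \<open>\<eta>\<close> up to a reflection, so
  that a single estimate on \<open>\<integral> \<psi> \<cdot> inv_fourier \<eta>\<close> serves both the \<open>L\<^sup>1\<close> and the continuous case.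
\<close>

lemma psi_D_dist_of_frequency_side:
  fixes \<psi> \<eta> u :: "real ^ 'n \<Rightarrow> complex"
  assumes \<psi>[measurable]: "\<psi> \<in> borel_measurable borel" and bdd: "\<And>\<xi>. norm (\<psi> \<xi>) \<le> C"
    and u: "u \<in> borel_measurable borel" "integrable lborel u"
    and \<eta>: "\<eta> \<in> borel_measurable borel" "integrable lborel (inv_fourier \<eta>)"
  shows "psi_D \<psi> (dist_of u) \<eta> = (LINT \<xi>|lborel. \<psi> \<xi> * inv_fourier \<eta> \<xi> * fourier u \<xi>)"
proof -
  note [measurable] = u(1) \<eta>(1)
  let ?v = "\<lambda>\<xi>. \<psi> \<xi> * inv_fourier \<eta> \<xi>"
  have v: "integrable lborel ?v" by (rule integrable_symbol_mult[OF \<psi> bdd \<eta>(2)])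
  have "psi_D \<psi> (dist_of u) \<eta> = (LINT x|lborel. u x * fourier ?v x)"
    by (rule psi_D_dist_of_space_side) measurable
  also have "\<dots> = (LINT x|lborel. LINT \<xi>|lborel. u x * (exp (- \<i> * complex_of_real (\<xi> \<bullet> x)) * ?v \<xi>))"
    by (subst fourier_lborel) simp_all
  also have "\<dots> = (LINT \<xi>|lborel. LINT x|lborel. u x * (exp (- \<i> * complex_of_real (\<xi> \<bullet> x)) * ?v \<xi>))"
    by (rule lborel_Fubini_dominated[OF _ integrable_norm[OF u(2)] integrable_norm[OF v]]) (simp_all add: norm_mult)
  also have "\<dots> = (LINT \<xi>|lborel. ?v \<xi> * fourier u \<xi>)"
    by (subst fourier_lborel) (simp_all add: inner_commute mult_ac flip: integral_mult_right_zero)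
  finally show ?thesis .
qed

definition unit_cube :: "(real ^ 'n) set" where
  "unit_cube = cbox (vec (-1)) (vec 1)"

lemma mem_unit_cube: "x \<in> unit_cube \<longleftrightarrow> (\<forall>i. \<bar>x $ i\<bar> \<le> 1)"
  by (auto simp: unit_cube_def mem_box_cart abs_le_iff)

lemma compact_unit_cube: "compact unit_cube"
  by (simp add: unit_cube_def)

lemma unit_cube_measurable [measurable]: "unit_cube \<in> sets borel"
  by (simp add: unit_cube_def)

text \<open>
  Both arguments of the pairing are taken from this class. Integrability of the transform is part of the
  definition: it is the one property on the Fourier side that the pairing uses, and it passes to finite sums and
  reflections.
\<close>

definition cube_tests :: "(real ^ 'n \<Rightarrow> complex) set" where
  "cube_tests = {\<eta> \<in> flat_algebra. (\<forall>x. x \<notin> unit_cube \<longrightarrow> \<eta> x = 0) \<and> integrable lborel (inv_fourier \<eta>)}"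

lemma cube_tests_continuous: "\<eta> \<in> cube_tests \<Longrightarrow> continuous_on A \<eta>"
  by (simp add: cube_tests_def flat_algebra_continuous)

lemma cube_tests_measurable: "\<eta> \<in> cube_tests \<Longrightarrow> \<eta> \<in> borel_measurable borel"
  by (intro borel_measurable_continuous_onI cube_tests_continuous)

lemma supp_subset_closed: "closed K \<Longrightarrow> (\<And>x. x \<notin> K \<Longrightarrow> f x = 0) \<Longrightarrow> supp f \<subseteq> K"
  unfolding supp_def by (intro closure_minimal) auto

lemma compact_supp_unit_cube:
  "(\<And>x. x \<notin> unit_cube \<Longrightarrow> f x = 0) \<Longrightarrow> compact (supp f)"
  using supp_subset_closed[of unit_cube f] compact_unit_cube
  by (auto simp: compact_eq_bounded_closed supp_def intro: bounded_subset)

lemma cube_tests_test_function: "\<eta> \<in> cube_tests \<Longrightarrow> test_function \<eta>"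
  unfolding test_function_def cube_tests_def
  using compact_supp_unit_cube flat_algebra_smooth by auto

lemma cube_tests_integrable:
  assumes \<eta>: "\<eta> \<in> cube_tests"
  shows "integrable lborel \<eta>"
proof -
  have "integrable lborel (\<lambda>x. indicator unit_cube x *\<^sub>R \<eta> x)"
    using borel_integrable_compact[OF compact_unit_cube cube_tests_continuous[OF \<eta>]] by simp
  moreover have "(\<lambda>x. indicator unit_cube x *\<^sub>R \<eta> x) = \<eta>"
    using \<eta> by (auto simp: cube_tests_def indicator_def)
  ultimately show ?thesis by simp
qed

lemma cube_tests_reflect:
  assumes \<eta>: "\<eta> \<in> cube_tests"
  shows "(\<lambda>x. \<eta> (- x)) \<in> cube_tests"
    and "inv_fourier (\<lambda>x. \<eta> (- x)) \<xi> = inv_fourier \<eta> (- \<xi>)"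
proof -
  have reflect: "(\<lambda>x. f (- x)) \<in> flat_algebra" if "f \<in> flat_algebra" for f :: "real ^ 'n \<Rightarrow> complex"
    using that
  proof induction
    case (character \<zeta>)
    show ?case using flat_algebra.character[of "- \<zeta>"] by simp
  next
    case (flat_exp k a b j)
    show ?case using flat_algebra.flat_exp[of k a "- b" j] by simp
  qed (auto intro: flat_algebra.intros)
  have [measurable]: "\<eta> \<in> borel_measurable borel" by (rule cube_tests_measurable[OF \<eta>])
  have eq: "inv_fourier (\<lambda>x. \<eta> (- x)) \<xi> = inv_fourier \<eta> (- \<xi>)" for \<xi>
    by (simp add: inv_fourier_lborel) (subst lborel_integral_affine(2)[where c = "-1" and t = 0], simp_all)
  then show "inv_fourier (\<lambda>x. \<eta> (- x)) \<xi> = inv_fourier \<eta> (- \<xi>)" .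
  have "integrable lborel (inv_fourier (\<lambda>x. \<eta> (- x)))"
    using \<eta> lborel_integrable_affine_iff[of "inv_fourier \<eta>" "-1" 0]
    by (simp add: eq[abs_def] cube_tests_def)
  then show "(\<lambda>x. \<eta> (- x)) \<in> cube_tests"
    using \<eta> reflect by (auto simp: cube_tests_def mem_unit_cube)
qed

lemma mollifier_cube_tests:
  assumes "m \<ge> 1"
  shows "mollifier m \<in> cube_tests"
  using assms mollifier_flat_algebra integrable_inv_fourier_mollifier[of m] mollifier_eq_0
  by (auto simp: cube_tests_def mem_unit_cube not_le)

abbreviation Linf_ball :: "(real ^ 'n \<Rightarrow> complex) set" where
  "Linf_ball \<equiv> {\<eta> \<in> cube_tests. \<forall>x. norm (\<eta> x) \<le> 1}"

abbreviation L1_ball :: "(real ^ 'n \<Rightarrow> complex) set" where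
  "L1_ball \<equiv> {\<eta> \<in> cube_tests. (LINT x|lborel. norm (\<eta> x)) \<le> 1}"

lemma Linf_ball_integral_norm:
  fixes \<eta> :: "real ^ 'n \<Rightarrow> complex"
  assumes "\<eta> \<in> Linf_ball"
  shows "(LINT x|lborel. norm (\<eta> x)) \<le> measure lborel (unit_cube :: (real ^ 'n) set)"
proof -
  have "(LINT x|lborel. norm (\<eta> x)) \<le> (LINT x|lborel. indicator (unit_cube :: (real ^ 'n) set) x)"
  proof (rule Bochner_Integration.integral_mono)
    show "integrable lborel (\<lambda>x. norm (\<eta> x))" using assms cube_tests_integrable by auto
    show "integrable lborel (indicator unit_cube :: real ^ 'n \<Rightarrow> real)"
      using emeasure_compact_finite[OF compact_unit_cube] by (intro integrable_real_indicator) auto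
    show "norm (\<eta> x) \<le> indicator unit_cube x" for x
      using assms by (auto simp: cube_tests_def indicator_def)
  qed
  then show ?thesis by simp
qed

text \<open>
  The series of the gliding hump may be integrated term by term against a bounded function. The terms are
  only bounded in \<open>L\<^sup>1\<close>, so pointwise convergence holds almost everywhere, by monotone convergence for the
  norms; elsewhere \<open>suminf\<close> takes some irrelevant value.
\<close>

lemma series_integrable:
  fixes u :: "nat \<Rightarrow> real ^ 'n \<Rightarrow> complex"
  assumes u: "\<And>k. u k \<in> borel_measurable borel" "\<And>k. integrable lborel (u k)"
    and bdd: "\<And>k. (LINT x|lborel. norm (u k x)) \<le> A"
    and s: "\<And>k. s k \<in> {0, 1 :: real}"
    and v: "v \<in> borel_measurable borel" "\<And>x. norm (v x) \<le> C"
  defines "f \<equiv> \<lambda>x. \<Sum>k. complex_of_real (s k / 4 ^ k) * u k x"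
  shows "f \<in> borel_measurable borel"
    and "integrable lborel f"
    and "(\<lambda>k. complex_of_real (s k / 4 ^ k) * (LINT x|lborel. u k x * v x)) sums (LINT x|lborel. f x * v x)"
proof -
  note [measurable] = u(1) v(1)
  let ?g = "\<lambda>k x. complex_of_real (s k / 4 ^ k) * u k x"
  have norm_g: "norm (?g k x) = s k / 4 ^ k * norm (u k x)" for k x
    using s[of k] by (auto simp: norm_mult norm_divide norm_power)
  have norm_int: "(LINT x|lborel. norm (?g k x)) \<le> (1 / 4) ^ k * A" for k
  proof -
    have "(LINT x|lborel. norm (?g k x)) = s k / 4 ^ k * (LINT x|lborel. norm (u k x))"
      unfolding norm_g by simp
    also have "\<dots> \<le> 1 / 4 ^ k * A"
      using s[of k] bdd[of k] by (intro mult_mono divide_right_mono) (auto intro: order.trans[OF Bochner_Integration.integral_nonneg bdd])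
    finally show ?thesis by (simp add: power_divide)
  qed
  have geo: "summable (\<lambda>k. (1 / 4 :: real) ^ k * A)"
    by (intro summable_mult2 summable_geometric) simp
  have summ: "summable (\<lambda>k. LINT x|lborel. norm (?g k x))"
    by (rule summable_comparison_test'[OF geo]) (use norm_int in auto)
  have g_int: "integrable lborel (?g k)" for k using u by simp
  have "(\<integral>\<^sup>+x. (\<Sum>k. ennreal (norm (?g k x))) \<partial>lborel) = (\<Sum>k. ennreal (LINT x|lborel. norm (?g k x)))"
    using g_int by (subst nn_integral_suminf) (auto simp: nn_integral_eq_integral)
  also have "\<dots> \<noteq> \<infinity>"
    using summ by (simp add: suminf_ennreal2)
  finally have "AE x in lborel. (\<Sum>k. ennreal (norm (?g k x))) \<noteq> \<infinity>"
    by (intro nn_integral_PInf_AE) measurable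
  then have AE_summ: "AE x in lborel. summable (\<lambda>k. norm (?g k x))"
    by eventually_elim (auto intro: summable_suminf_not_top)
  show f[measurable]: "f \<in> borel_measurable borel" unfolding f_def by measurable
  show "integrable lborel f"
    unfolding f_def by (rule integrable_suminf[OF g_int AE_summ summ])
  have C: "C \<ge> 0" using v(2)[of 0] norm_ge_zero order.trans by blast
  let ?h = "\<lambda>k x. ?g k x * v x"
  have h_int: "integrable lborel (?h k)" for k
    using integrable_symbol_mult[OF v g_int[of k]] by (simp add: mult.commute)
  have le: "norm (?h k x) \<le> norm (?g k x) * C" for k x
    unfolding norm_mult[of "?g k x"] by (rule mult_left_mono[OF v(2) norm_ge_zero])
  have "AE x in lborel. summable (\<lambda>k. norm (?h k x))"
    using AE_summ
  proof eventually_elim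
    case (elim x)
    show ?case
      by (rule summable_comparison_test'[OF summable_mult2[OF elim, of C]]) (use le in auto)
  qed
  moreover have "summable (\<lambda>k. LINT x|lborel. norm (?h k x))"
  proof (rule summable_comparison_test'[OF summable_mult2[OF summ, of C]])
    fix k
    have "(LINT x|lborel. norm (?h k x)) \<le> (LINT x|lborel. norm (?g k x) * C)"
      using h_int g_int le by (intro Bochner_Integration.integral_mono) auto
    then show "norm (LINT x|lborel. norm (?h k x)) \<le> (LINT x|lborel. norm (?g k x)) * C" by simp
  qed
  ultimately have "(\<lambda>k. LINT x|lborel. ?h k x) sums (LINT x|lborel. (\<Sum>k. ?h k x))"
    by (intro sums_integral h_int)
  moreover have "(LINT x|lborel. (\<Sum>k. ?h k x)) = (LINT x|lborel. f x * v x)"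
  proof (rule integral_cong_AE)
    show "AE x in lborel. (\<Sum>k. ?h k x) = f x * v x"
      using AE_summ
    proof eventually_elim
      case (elim x)
      show ?case unfolding f_def by (rule suminf_mult2[symmetric, OF summable_norm_cancel[OF elim]])
    qed
  qed measurable
  ultimately show "(\<lambda>k. complex_of_real (s k / 4 ^ k) * (LINT x|lborel. u k x * v x)) sums (LINT x|lborel. f x * v x)"
    by (simp add: mult.assoc)
qed

text \<open>
  The next two lemmas are the continuity estimates that the distribution \<open>\<psi>(D)f\<close> would have to satisfy
  if it were given by a function in the respective local Lebesgue space.
\<close>

lemma Linf_locD:
  assumes h: "h \<in> Linf_loc"
  shows "\<exists>C\<ge>0. \<forall>\<eta>\<in>L1_ball. norm (dist_of h \<eta>) \<le> C"
proof -
  from h have [measurable]: "h \<in> borel_measurable lebesgue" by (simp add: Linf_loc_def)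
  obtain C0 where "AE x in lebesgue. x \<in> unit_cube \<longrightarrow> norm (h x) \<le> C0"
    using h compact_unit_cube by (auto simp: Linf_loc_def)
  then have C: "AE x in lebesgue. x \<in> unit_cube \<longrightarrow> norm (h x) \<le> max C0 0" by eventually_elim auto
  have "norm (dist_of h \<eta>) \<le> max C0 0" if \<eta>: "\<eta> \<in> L1_ball" for \<eta>
  proof -
    have m[measurable]: "\<eta> \<in> borel_measurable lebesgue"
      using \<eta> by (auto intro: borel_imp_lebesgue_measurable cube_tests_measurable)
    have int: "integrable lebesgue \<eta>"
      using \<eta> cube_tests_integrable cube_tests_measurable by (subst integrable_completion) auto
    have AE: "AE x in lebesgue. norm (h x * \<eta> x) \<le> max C0 0 * norm (\<eta> x)"
      using C
    proof eventually_elim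
      case (elim x)
      show ?case
        using elim \<eta> by (cases "x \<in> unit_cube") (auto simp: norm_mult cube_tests_def intro: mult_right_mono)
    qed
    have h\<eta>: "integrable lebesgue (\<lambda>x. h x * \<eta> x)"
      by (rule Bochner_Integration.integrable_bound[of _ "\<lambda>x. max C0 0 * norm (\<eta> x)"])
        (use int AE in \<open>auto elim!: eventually_mono\<close>)
    have "norm (dist_of h \<eta>) \<le> (LINT x|lebesgue. norm (h x * \<eta> x))"
      unfolding dist_of_def by (rule integral_norm_bound)
    also have "\<dots> \<le> (LINT x|lebesgue. max C0 0 * norm (\<eta> x))"
      using h\<eta> int AE by (intro integral_mono_AE) auto
    also have "\<dots> = max C0 0 * (LINT x|lborel. norm (\<eta> x))"
    proof -
      have [measurable]: "\<eta> \<in> borel_measurable borel" using \<eta> cube_tests_measurable by auto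
      show ?thesis by (subst integral_completion) simp_all
    qed
    also have "\<dots> \<le> max C0 0 * 1" using \<eta> by (intro mult_left_mono) auto
    finally show ?thesis by simp
  qed
  then show ?thesis by (intro exI[of _ "max C0 0"]) auto
qed

lemma L1_locD:
  assumes h: "h \<in> L1_loc"
  shows "\<exists>C. \<forall>\<eta>\<in>Linf_ball. norm (dist_of h \<eta>) \<le> C"
proof -
  have int: "integrable lebesgue (\<lambda>x. indicator unit_cube x *\<^sub>R h x)"
    using h compact_unit_cube by (auto simp: L1_loc_def set_integrable_def)
  have "norm (dist_of h \<eta>) \<le> (LINT x|lebesgue. norm (indicator unit_cube x *\<^sub>R h x))"
    if \<eta>: "\<eta> \<in> Linf_ball" for \<eta>
  proof -
    have "norm (dist_of h \<eta>) \<le> (LINT x|lebesgue. norm (h x * \<eta> x))"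
      unfolding dist_of_def by (rule integral_norm_bound)
    also have "\<dots> \<le> (LINT x|lebesgue. norm (indicator unit_cube x *\<^sub>R h x))"
    proof (rule integral_mono')
      show "norm (h x * \<eta> x) \<le> norm (indicator unit_cube x *\<^sub>R h x)" for x
        using \<eta> by (cases "x \<in> unit_cube") (auto simp: norm_mult cube_tests_def intro: mult_left_le)
    qed (use integrable_norm[OF int] in auto)
    finally show ?thesis .
  qed
  then show ?thesis by blast
qed

lemma cont_functions_subset_Linf_loc: "cont_functions \<subseteq> (Linf_loc :: (real ^ 'n \<Rightarrow> complex) set)"
proof
  fix f :: "real ^ 'n \<Rightarrow> complex" assume "f \<in> cont_functions"
  then have f: "continuous_on UNIV f" by (simp add: cont_functions_def)
  have "\<exists>C. AE x in lebesgue. x \<in> K \<longrightarrow> norm (f x) \<le> C" if K: "compact K" for K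
  proof -
    have "bounded (f ` K)"
      using compact_continuous_image[OF continuous_on_subset[OF f] K] compact_imp_bounded by blast
    then show ?thesis by (auto simp: bounded_iff)
  qed
  then show "f \<in> Linf_loc"
    using f by (auto simp: Linf_loc_def intro: borel_imp_lebesgue_measurable borel_measurable_continuous_onI)
qed

lemma cont_comp_subset_Linf_comp: "cont_comp \<subseteq> (Linf_comp :: (real ^ 'n \<Rightarrow> complex) set)"
proof
  fix f :: "real ^ 'n \<Rightarrow> complex" assume "f \<in> cont_comp"
  then have f: "continuous_on UNIV f" "compact (supp f)" by (simp_all add: cont_comp_def)
  have 0: "f x = 0" if "x \<notin> supp f" for x
    using that closure_subset[of "{x. f x \<noteq> 0}"] by (auto simp: supp_def)
  have "f \<in> Linf_loc" using f cont_functions_subset_Linf_loc by (auto simp: cont_functions_def)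
  then obtain C where "AE x in lebesgue. x \<in> supp f \<longrightarrow> norm (f x) \<le> C" and m: "f \<in> borel_measurable lebesgue"
    using f(2) by (auto simp: Linf_loc_def)
  then have "AE x in lebesgue. norm (f x) \<le> max C 0" using 0 by (auto elim!: eventually_mono)
  moreover have "ess_compact_supp f"
    unfolding ess_compact_supp_def using f(2) 0 by blast
  ultimately show "f \<in> Linf_comp" using m by (auto simp: Linf_comp_def)
qed

section \<open>From an unbounded kernel to ill-posedness\<close>

lemma not_given_by_elem_of_unbounded:
  assumes E: "E \<subseteq> cube_tests"
    and X: "\<And>h. h \<in> X \<Longrightarrow> \<exists>C. \<forall>\<eta>\<in>E. norm (dist_of h \<eta>) \<le> C"
    and unbdd: "\<forall>M. \<exists>\<eta>\<in>E. norm (T \<eta>) > M"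
  shows "\<not> given_by_elem T X"
proof
  assume "given_by_elem T X"
  then obtain h where h: "h \<in> X" "\<And>\<eta>. test_function \<eta> \<Longrightarrow> T \<eta> = dist_of h \<eta>"
    by (auto simp: given_by_elem_def)
  obtain C where C: "\<And>\<eta>. \<eta> \<in> E \<Longrightarrow> norm (dist_of h \<eta>) \<le> C" using X[OF h(1)] by blast
  obtain \<eta> where \<eta>: "\<eta> \<in> E" "norm (T \<eta>) > C" using unbdd by blast
  then have "T \<eta> = dist_of h \<eta>" using h(2) E cube_tests_test_function by blast
  then show False using C[OF \<eta>(1)] \<eta>(2) by simp
qed

text \<open>
  The hypothesis says that the convolution kernel of \<open>\<psi>(D)\<close>, tested against functions supported in the
  unit cube, is not a measure. Replacing the point mass by \<open>u =\<close> mollifier makes the pairing large for \<open>u\<close> in the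
  \<open>L\<^sup>1\<close> ball and \<open>\<eta>\<close> in the \<open>L\<^sup>\<infinity>\<close> ball. With the roles exchanged and one argument reflected the same number
  appears for \<open>u\<close> in the \<open>L\<^sup>\<infinity>\<close> ball and \<open>\<eta>\<close> in the \<open>L\<^sup>1\<close> ball. In both cases the gliding hump
  yields one function \<open>f\<close>; in the second the series converges uniformly, so \<open>f\<close> is continuous.
\<close>

lemma ill_posed_of_unbounded_kernel:
  fixes \<psi> :: "real ^ 'n \<Rightarrow> complex"
  assumes \<psi>[measurable]: "\<psi> \<in> borel_measurable borel" and bdd: "\<And>\<xi>. norm (\<psi> \<xi>) \<le> C"
    and kernel: "\<And>M. \<exists>\<eta>\<in>Linf_ball. norm (LINT \<xi>|lborel. \<psi> \<xi> * inv_fourier \<eta> \<xi>) > M"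
  shows "\<exists>f\<in>L1_comp. \<forall>M. \<exists>\<eta>\<in>Linf_ball. norm (psi_D \<psi> (dist_of f) \<eta>) > M"
    and "\<exists>f\<in>cont_comp. \<forall>M. \<exists>\<eta>\<in>L1_ball. norm (psi_D \<psi> (dist_of f) \<eta>) > M"
proof -
  let ?v = "\<lambda>\<eta> \<xi>. \<psi> \<xi> * inv_fourier \<eta> \<xi>"
  let ?L = "measure lborel (unit_cube :: (real ^ 'n) set)"
  let ?S = "\<lambda>u s x. \<Sum>k. complex_of_real (s k / 4 ^ k) * u k x"
  have v_int: "integrable lborel (?v \<eta>)" if "\<eta> \<in> cube_tests" for \<eta>
    using that by (intro integrable_symbol_mult[OF \<psi> bdd]) (simp add: cube_tests_def)
  have v_meas: "?v \<eta> \<in> borel_measurable borel" if "\<eta> \<in> cube_tests" for \<eta>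
    using cube_tests_measurable[OF that] by measurable
  have pairing: "psi_D \<psi> (dist_of u) \<eta> = (LINT \<xi>|lborel. ?v \<eta> \<xi> * fourier u \<xi>)"
    if "u \<in> cube_tests" "\<eta> \<in> cube_tests" for u \<eta>
    using that by (intro psi_D_dist_of_frequency_side[OF \<psi> bdd])
      (auto intro: cube_tests_measurable cube_tests_integrable simp: cube_tests_def)
  have bound: "norm (psi_D \<psi> (dist_of u) \<eta>) \<le> (LINT \<xi>|lborel. norm (?v \<eta> \<xi>)) * A"
    if u: "u \<in> cube_tests" and \<eta>: "\<eta> \<in> cube_tests" and A: "(LINT x|lborel. norm (u x)) \<le> A" for u \<eta> A
  proof -
    have [measurable]: "u \<in> borel_measurable borel" "\<eta> \<in> borel_measurable borel"
      using u \<eta> cube_tests_measurable by auto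
    have "norm (psi_D \<psi> (dist_of u) \<eta>) \<le> (LINT \<xi>|lborel. norm (?v \<eta> \<xi> * fourier u \<xi>))"
      unfolding pairing[OF u \<eta>] by (rule integral_norm_bound)
    also have "\<dots> \<le> (LINT \<xi>|lborel. norm (?v \<eta> \<xi>) * A)"
    proof (rule integral_mono')
      show "integrable lborel (\<lambda>\<xi>. norm (?v \<eta> \<xi>) * A)" using v_int[OF \<eta>] by auto
      show "norm (?v \<eta> \<xi> * fourier u \<xi>) \<le> norm (?v \<eta> \<xi>) * A" for \<xi>
        unfolding norm_mult[of "?v \<eta> \<xi>"]
        using norm_fourier_le[of u \<xi>] A by (intro mult_left_mono) auto
      have "0 \<le> A" using A by (rule order.trans[rotated]) simp
      then show "0 \<le> norm (?v \<eta> \<xi>) * A" for \<xi> by simp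
    qed
    finally show ?thesis by simp
  qed
  have series:
    "?S u s \<in> borel_measurable borel" "integrable lborel (?S u s)" "x \<notin> unit_cube \<Longrightarrow> ?S u s x = 0"
    "\<eta> \<in> cube_tests \<Longrightarrow>
      (\<lambda>k. complex_of_real (s k / 4 ^ k) * psi_D \<psi> (dist_of (u k)) \<eta>) sums psi_D \<psi> (dist_of (?S u s)) \<eta>"
    if u: "\<And>k. u k \<in> cube_tests" and A: "\<And>k. (LINT x|lborel. norm (u k x)) \<le> A"
      and s: "\<And>k. s k \<in> {0, 1 :: real}" for u s A \<eta> x
  proof -
    have um[measurable]: "u k \<in> borel_measurable borel" for k using cube_tests_measurable[OF u] .
    have ui: "integrable lborel (u k)" for k using cube_tests_integrable[OF u] .
    note * = series_integrable[where u = u and s = s, OF um ui A s]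
    show S: "?S u s \<in> borel_measurable borel" and "integrable lborel (?S u s)"
      using *(1,2)[of "\<lambda>_. 0" 0] by simp_all
    show "x \<notin> unit_cube \<Longrightarrow> ?S u s x = 0" using u by (simp add: cube_tests_def)
    assume \<eta>: "\<eta> \<in> cube_tests"
    note \<eta>m = cube_tests_measurable[OF \<eta>]
    have "fourier (?v \<eta>) \<in> borel_measurable borel" by (intro fourier_measurable v_meas \<eta>)
    from *(3)[OF this norm_fourier_le[OF v_meas[OF \<eta>]]]
    show "(\<lambda>k. complex_of_real (s k / 4 ^ k) * psi_D \<psi> (dist_of (u k)) \<eta>) sums psi_D \<psi> (dist_of (?S u s)) \<eta>"
      unfolding psi_D_dist_of_space_side[OF \<psi> S \<eta>m] psi_D_dist_of_space_side[OF \<psi> um \<eta>m] .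
  qed
  show "\<exists>f\<in>L1_comp. \<forall>M. \<exists>\<eta>\<in>Linf_ball. norm (psi_D \<psi> (dist_of f) \<eta>) > M"
  proof (rule gliding_hump[where U = L1_ball])
    show "\<exists>M. \<forall>u\<in>L1_ball. norm (psi_D \<psi> (dist_of u) \<eta>) \<le> M" if "\<eta> \<in> Linf_ball" for \<eta>
      using bound[of _ \<eta> 1] that by blast
  next
    fix u :: "nat \<Rightarrow> real ^ 'n \<Rightarrow> complex" and s :: "nat \<Rightarrow> real"
    assume "\<And>k. u k \<in> L1_ball" and s: "\<And>k. s k \<in> {0, 1}"
    then have u: "\<And>k. u k \<in> cube_tests" "\<And>k. (LINT x|lborel. norm (u k x)) \<le> 1" by auto
    have *: "integrable lborel (?S u s)" "?S u s \<in> borel_measurable borel"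
      "\<And>x. x \<notin> unit_cube \<Longrightarrow> ?S u s x = 0"
      "\<And>\<eta>. \<eta> \<in> cube_tests \<Longrightarrow>
        (\<lambda>k. complex_of_real (s k / 4 ^ k) * psi_D \<psi> (dist_of (u k)) \<eta>) sums psi_D \<psi> (dist_of (?S u s)) \<eta>"
      by (rule series(2) series(1) series(3) series(4); (rule u(1) u(2) s | assumption))+
    have "?S u s \<in> L1_comp"
      using *(1-3) compact_unit_cube by (auto simp: L1_comp_def integrable_completion ess_compact_supp_def)
    then show "\<exists>f\<in>L1_comp. \<forall>\<eta>\<in>Linf_ball.
        (\<lambda>k. complex_of_real (s k / 4 ^ k) * psi_D \<psi> (dist_of (u k)) \<eta>) sums psi_D \<psi> (dist_of f) \<eta>"
      using *(4) by blast
  next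
    fix M
    obtain \<eta> where \<eta>: "\<eta> \<in> Linf_ball" and large: "norm (LINT \<xi>|lborel. ?v \<eta> \<xi>) > M" using kernel by blast
    then have \<eta>': "\<eta> \<in> cube_tests" by simp
    have "(\<lambda>m. LINT \<xi>|lborel. ?v \<eta> \<xi> * fourier (mollifier (Suc m)) \<xi>) \<longlonglongrightarrow> (LINT \<xi>|lborel. ?v \<eta> \<xi> * 1)"
    proof (rule integral_dominated_convergence[where w = "\<lambda>\<xi>. norm (?v \<eta> \<xi>)"])
      show "(\<lambda>\<xi>. ?v \<eta> \<xi> * fourier (mollifier (Suc m)) \<xi>) \<in> borel_measurable lborel" for m
        using borel_measurable_times[OF v_meas[OF \<eta>']
            fourier_measurable[OF cube_tests_measurable[OF mollifier_cube_tests[of "Suc m"]]]] by simp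
      show "AE \<xi> in lborel. (\<lambda>m. ?v \<eta> \<xi> * fourier (mollifier (Suc m)) \<xi>) \<longlonglongrightarrow> ?v \<eta> \<xi> * 1"
        by (intro AE_I2 tendsto_mult tendsto_const fourier_mollifier_tendsto)
      show "AE \<xi> in lborel. norm (?v \<eta> \<xi> * fourier (mollifier (Suc m)) \<xi>) \<le> norm (?v \<eta> \<xi>)" for m
        unfolding norm_mult[of "?v \<eta> _"] by (intro AE_I2 mult_left_le norm_fourier_mollifier_le) auto
    qed (use v_int[OF \<eta>'] v_meas[OF \<eta>'] in auto)
    then have "\<forall>\<^sub>F m in sequentially. M < norm (LINT \<xi>|lborel. ?v \<eta> \<xi> * fourier (mollifier (Suc m)) \<xi>)"
      using large by (intro order_tendstoD(1)[OF tendsto_norm]) auto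
    then obtain m where "M < norm (LINT \<xi>|lborel. ?v \<eta> \<xi> * fourier (mollifier (Suc m)) \<xi>)"
      using eventually_happens'[OF sequentially_bot] by blast
    moreover have "mollifier (Suc m) \<in> cube_tests" by (rule mollifier_cube_tests) simp
    moreover have "(LINT x|lborel. norm (mollifier (Suc m) (x :: real ^ 'n))) \<le> 1"
      by (subst integral_norm_mollifier) auto
    ultimately show "\<exists>u\<in>L1_ball. \<exists>\<eta>\<in>Linf_ball. norm (psi_D \<psi> (dist_of u) \<eta>) > M"
      using \<eta> pairing[of "mollifier (Suc m)" \<eta>] by (intro bexI[of _ "mollifier (Suc m)"] bexI[of _ \<eta>]) auto
  qed
  show "\<exists>f\<in>cont_comp. \<forall>M. \<exists>\<eta>\<in>L1_ball. norm (psi_D \<psi> (dist_of f) \<eta>) > M"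
  proof (rule gliding_hump[where U = Linf_ball])
    show "\<exists>M. \<forall>u\<in>Linf_ball. norm (psi_D \<psi> (dist_of u) \<eta>) \<le> M" if "\<eta> \<in> L1_ball" for \<eta>
      using bound[of _ \<eta> ?L] that Linf_ball_integral_norm by blast
  next
    fix u :: "nat \<Rightarrow> real ^ 'n \<Rightarrow> complex" and s :: "nat \<Rightarrow> real"
    assume u_ball: "\<And>k. u k \<in> Linf_ball" and s: "\<And>k. s k \<in> {0, 1}"
    then have u: "\<And>k. u k \<in> cube_tests" and u_le: "\<And>k x. norm (u k x) \<le> 1" by auto
    have *: "integrable lborel (?S u s)" "?S u s \<in> borel_measurable borel"
      "\<And>x. x \<notin> unit_cube \<Longrightarrow> ?S u s x = 0"
      "\<And>\<eta>. \<eta> \<in> cube_tests \<Longrightarrow>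
        (\<lambda>k. complex_of_real (s k / 4 ^ k) * psi_D \<psi> (dist_of (u k)) \<eta>) sums psi_D \<psi> (dist_of (?S u s)) \<eta>"
      by (rule series(2) series(1) series(3) series(4); (rule u Linf_ball_integral_norm[OF u_ball] s | assumption))+
    have "uniform_limit UNIV (\<lambda>n x. \<Sum>k<n. complex_of_real (s k / 4 ^ k) * u k x) (?S u s) sequentially"
    proof (rule Weierstrass_m_test)
      show "norm (complex_of_real (s k / 4 ^ k) * u k x) \<le> (1 / 4) ^ k" for k x
        using u_le[of k x] s[of k] by (auto simp: norm_mult norm_divide norm_power power_divide intro: divide_right_mono)
    qed (intro summable_geometric, simp)
    then have "continuous_on UNIV (?S u s)"
      by (rule uniform_limit_theorem[rotated])
        (rule sequentially_bot, intro always_eventually allI continuous_intros cube_tests_continuous[OF u])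
    then have "?S u s \<in> cont_comp"
      using *(3) compact_supp_unit_cube[of "?S u s"] by (simp add: cont_comp_def)
    then show "\<exists>f\<in>cont_comp. \<forall>\<eta>\<in>L1_ball.
        (\<lambda>k. complex_of_real (s k / 4 ^ k) * psi_D \<psi> (dist_of (u k)) \<eta>) sums psi_D \<psi> (dist_of f) \<eta>"
      using *(4) by blast
  next
    fix M
    let ?c = "complex_of_real ((2 * pi) ^ CARD('n))"
    obtain \<eta> where \<eta>: "\<eta> \<in> Linf_ball" and large: "norm (LINT \<xi>|lborel. ?v \<eta> \<xi>) > M" using kernel by blast
    then have \<eta>': "\<eta> \<in> cube_tests" by simp
    let ?u = "\<lambda>x. \<eta> (- x)"
    have u: "?u \<in> Linf_ball" using \<eta> cube_tests_reflect(1)[OF \<eta>'] by simp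
    have fourier_u: "fourier ?u \<xi> = ?c * inv_fourier \<eta> \<xi>" for \<xi>
      using cube_tests_reflect(2)[OF \<eta>'] by (simp add: fourier_conv_inv_fourier)
    have "(\<lambda>m. LINT \<xi>|lborel. ?v \<eta> \<xi> * (?c * inv_fourier (mollifier (Suc m)) \<xi>)) \<longlonglongrightarrow> (LINT \<xi>|lborel. ?v \<eta> \<xi> * (?c * (1 / ?c)))"
    proof (rule integral_dominated_convergence[where w = "\<lambda>\<xi>. norm (?v \<eta> \<xi>)"])
      show "(\<lambda>\<xi>. ?v \<eta> \<xi> * (?c * inv_fourier (mollifier (Suc m)) \<xi>)) \<in> borel_measurable lborel" for m
        using borel_measurable_times[OF v_meas[OF \<eta>'] borel_measurable_times[OF borel_measurable_const[of ?c]
            inv_fourier_measurable[OF cube_tests_measurable[OF mollifier_cube_tests[of "Suc m"]]]]] by simp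
      show "AE \<xi> in lborel. (\<lambda>m. ?v \<eta> \<xi> * (?c * inv_fourier (mollifier (Suc m)) \<xi>)) \<longlonglongrightarrow> ?v \<eta> \<xi> * (?c * (1 / ?c))"
        by (intro AE_I2 tendsto_mult tendsto_const fourier_mollifier_tendsto)
      have "norm (?c * inv_fourier (mollifier (Suc m)) \<xi>) \<le> 1" for m and \<xi> :: "real ^ 'n"
        using norm_fourier_mollifier_le(2)[of "Suc m" \<xi>] by (simp add: norm_mult norm_power field_simps)
      then show "AE \<xi> in lborel. norm (?v \<eta> \<xi> * (?c * inv_fourier (mollifier (Suc m)) \<xi>)) \<le> norm (?v \<eta> \<xi>)" for m
        unfolding norm_mult[of "?v \<eta> _"] by (intro AE_I2 mult_left_le) auto
    qed (use v_int[OF \<eta>'] v_meas[OF \<eta>'] in auto)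
    then have "\<forall>\<^sub>F m in sequentially. M < norm (LINT \<xi>|lborel. ?v \<eta> \<xi> * (?c * inv_fourier (mollifier (Suc m)) \<xi>))"
      using large by (intro order_tendstoD(1)[OF tendsto_norm]) auto
    then obtain m where m: "M < norm (LINT \<xi>|lborel. ?v \<eta> \<xi> * (?c * inv_fourier (mollifier (Suc m)) \<xi>))"
      using eventually_happens'[OF sequentially_bot] by blast
    have w: "mollifier (Suc m) \<in> cube_tests" by (rule mollifier_cube_tests) simp
    have "psi_D \<psi> (dist_of ?u) (mollifier (Suc m)) = (LINT \<xi>|lborel. ?v \<eta> \<xi> * (?c * inv_fourier (mollifier (Suc m)) \<xi>))"
      using pairing[OF _ w, of ?u] u by (simp add: fourier_u mult_ac)
    moreover have "(LINT x|lborel. norm (mollifier (Suc m) (x :: real ^ 'n))) \<le> 1"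
      by (subst integral_norm_mollifier) auto
    ultimately show "\<exists>u\<in>Linf_ball. \<exists>\<eta>\<in>L1_ball. norm (psi_D \<psi> (dist_of u) \<eta>) > M"
      using u m w by (intro bexI[of _ ?u] bexI[of _ "mollifier (Suc m)"]) auto
  qed
qed

text \<open>
  The continuous function also serves as the element of \<open>L\<^sup>\<infinity>\<close>: \<open>\<psi>(D)\<phi>\<close> is shown not to be locally bounded,
  which is stronger than not being continuous.
\<close>

lemma ill_posed:
  fixes \<psi> :: "real ^ 'n \<Rightarrow> complex"
  assumes "\<psi> \<in> borel_measurable borel" and "\<And>\<xi>. norm (\<psi> \<xi>) \<le> C"
    and "\<And>M. \<exists>\<eta>\<in>Linf_ball. norm (LINT \<xi>|lborel. \<psi> \<xi> * inv_fourier \<eta> \<xi>) > M"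
  shows "\<exists>f \<in> L1_comp. \<exists>g \<in> Linf_comp. \<exists>\<phi> \<in> cont_comp.
           \<not> given_by_elem (psi_D \<psi> (dist_of f)) L1_loc \<and>
           \<not> given_by_elem (psi_D \<psi> (dist_of g)) Linf_loc \<and>
           \<not> given_by_elem (psi_D \<psi> (dist_of \<phi>)) cont_functions"
proof -
  obtain f where f: "f \<in> L1_comp" "\<forall>M. \<exists>\<eta>\<in>Linf_ball. norm (psi_D \<psi> (dist_of f) \<eta>) > M"
    using ill_posed_of_unbounded_kernel(1)[OF assms] by blast
  obtain \<phi> where \<phi>: "\<phi> \<in> cont_comp" "\<forall>M. \<exists>\<eta>\<in>L1_ball. norm (psi_D \<psi> (dist_of \<phi>) \<eta>) > M"
    using ill_posed_of_unbounded_kernel(2)[OF assms] by blast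
  have "\<not> given_by_elem (psi_D \<psi> (dist_of f)) L1_loc"
    by (rule not_given_by_elem_of_unbounded[OF _ L1_locD f(2)]) auto
  moreover have 1: "\<not> given_by_elem (psi_D \<psi> (dist_of \<phi>)) Linf_loc"
    by (rule not_given_by_elem_of_unbounded[OF _ _ \<phi>(2)]) (use Linf_locD in blast)+
  moreover have "\<not> given_by_elem (psi_D \<psi> (dist_of \<phi>)) cont_functions"
    using 1 cont_functions_subset_Linf_loc by (auto simp: given_by_elem_def)
  ultimately show ?thesis
    using f(1) \<phi>(1) cont_comp_subset_Linf_comp by blast
qed

section \<open>Lacunary sums of wave packets\<close>

lemma norm_iexp_diff_le: "norm (exp (\<i> * complex_of_real a) - exp (\<i> * complex_of_real b)) \<le> \<bar>a - b\<bar>"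
proof -
  have "exp (\<i> * complex_of_real a) - exp (\<i> * complex_of_real b)
      = exp (\<i> * complex_of_real b) * (exp (\<i> * complex_of_real (a - b)) - 1)"
    by (simp add: right_diff_distrib flip: exp_add)
  then show ?thesis using iexp_approx1[of "a - b" 0] by (simp add: norm_mult)
qed

text \<open>
  A geometric series dominated by its last term that does not exceed \<open>D\<close>; the point is that the bound is independent of \<open>N\<close>.
\<close>

lemma dyadic_sum_le:
  assumes "0 \<le> y" "0 \<le> D"
  shows "(\<Sum>k<N. if 2 ^ k * y \<le> D then 2 ^ k * y else 0) \<le> (2 * D :: real)"
proof -
  have "(\<Sum>k<N. if 2 ^ k * y \<le> D then 2 ^ k * y else 0) \<le> (if y \<le> D then 2 * D - y else 0)" if "0 \<le> y" for y
    using that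
  proof (induction N arbitrary: y)
    case 0
    then show ?case using assms by auto
  next
    case (Suc N)
    have "(\<Sum>k<Suc N. if 2 ^ k * y \<le> D then 2 ^ k * y else 0)
        = (if y \<le> D then y else 0) + (\<Sum>k<N. if 2 ^ k * (2 * y) \<le> D then 2 ^ k * (2 * y) else 0)"
      by (subst sum.lessThan_Suc_shift) (simp add: mult_ac cong: if_cong)
    also have "\<dots> \<le> (if y \<le> D then y else 0) + (if 2 * y \<le> D then 2 * D - 2 * y else 0)"
      using Suc.IH[of "2 * y"] Suc.prems by simp
    also have "\<dots> \<le> (if y \<le> D then 2 * D - y else 0)" using Suc.prems by auto
    finally show ?case .
  qed
  from this[OF assms(1)] show ?thesis using assms by (auto split: if_splits)
qed

text \<open>
  A wave packet: its inverse Fourier transform is a bump of total mass independent of \<open>s\<close>, centred at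
  frequency \<open>s \<zeta>\<close> with width \<open>b s\<close>. Changing \<open>s\<close> dilates the packet, in space and in frequency.
\<close>

definition wave :: "real \<Rightarrow> real ^ 'n \<Rightarrow> real \<Rightarrow> real ^ 'n \<Rightarrow> complex" where
  "wave b \<zeta> s x = exp (\<i> * complex_of_real (x \<bullet> (- (s *\<^sub>R \<zeta>)))) * cutoff ((b * s) *\<^sub>R x)"

lemma wave_flat_algebra: "wave b \<zeta> s \<in> flat_algebra"
  unfolding wave_def[abs_def] by (intro flat_algebra.mult flat_algebra.character cutoff_flat_algebra)

lemma inv_fourier_wave:
  fixes \<zeta> :: "real ^ 'n"
  assumes "b > 0" "s > 0"
  shows "inv_fourier (wave b \<zeta> s) \<xi> = inv_fourier cutoff ((1 / (b * s)) *\<^sub>R (\<xi> - s *\<^sub>R \<zeta>)) / complex_of_real ((b * s) ^ CARD('n))"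
  unfolding wave_def using assms by (intro inv_fourier_modulated_cutoff) simp

lemma wave_cube_tests:
  fixes \<zeta> :: "real ^ 'n"
  assumes "b > 0" "b * s \<ge> 1"
  shows "wave b \<zeta> s \<in> cube_tests"
proof -
  have bs: "b * s > 0" using assms by linarith
  then have s: "s > 0" using assms(1) by (simp add: zero_less_mult_iff)
  have "integrable lborel (\<lambda>\<xi>. inv_fourier cutoff (- (1 / b) *\<^sub>R \<zeta> + (1 / (b * s)) *\<^sub>R \<xi>))"
    using bs integrable_inv_fourier_cutoff by (subst lborel_integrable_affine_iff) auto
  moreover have "(1 / (b * s)) *\<^sub>R (\<xi> - s *\<^sub>R \<zeta>) = - (1 / b) *\<^sub>R \<zeta> + (1 / (b * s)) *\<^sub>R \<xi>" for \<xi>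
    using s by (simp add: algebra_simps)
  ultimately have "integrable lborel (inv_fourier (wave b \<zeta> s))"
    unfolding inv_fourier_wave[OF assms(1) s, abs_def] by (intro integrable_divide_zero) simp
  moreover have "wave b \<zeta> s x = 0" if x: "x \<notin> unit_cube" for x
  proof -
    obtain i where "\<not> \<bar>x $ i\<bar> \<le> 1" using x unfolding mem_unit_cube by blast
    then have i: "\<bar>x $ i\<bar> > 1" by simp
    have "1 * 1 \<le> (b * s) * \<bar>x $ i\<bar>" using assms i by (intro mult_mono) auto
    then have "cutoff ((b * s) *\<^sub>R x) = 0" using bs by (intro cutoff_eq_0[of _ i]) (simp add: abs_mult[of "b * s"])
    then show ?thesis by (simp add: wave_def)
  qed
  ultimately show ?thesis using wave_flat_algebra by (simp add: cube_tests_def)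
qed

lemma integral_symbol_wave:
  fixes \<zeta> :: "real ^ 'n"
  assumes [measurable]: "\<psi> \<in> borel_measurable borel" and bs: "b > 0" "s > 0"
  shows "(LINT \<xi>|lborel. \<psi> \<xi> * inv_fourier (wave b \<zeta> s) \<xi>)
    = (LINT \<xi>|lborel. \<psi> (s *\<^sub>R (\<zeta> + b *\<^sub>R \<xi>)) * inv_fourier cutoff \<xi>)"
proof -
  let ?f = "\<lambda>\<xi>. \<psi> \<xi> * (inv_fourier cutoff ((1 / (b * s)) *\<^sub>R (\<xi> - s *\<^sub>R \<zeta>)) / complex_of_real ((b * s) ^ CARD('n)))"
  have eq: "?f (s *\<^sub>R \<zeta> + (b * s) *\<^sub>R \<xi>)
      = (\<psi> (s *\<^sub>R (\<zeta> + b *\<^sub>R \<xi>)) * inv_fourier cutoff \<xi>) / complex_of_real ((b * s) ^ CARD('n))" for \<xi>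
    using bs by (simp add: scaleR_add_right mult.commute)
  have "(LINT \<xi>|lborel. ?f \<xi>)
      = \<bar>b * s\<bar> ^ CARD('n) *\<^sub>R (LINT \<xi>|lborel. ?f (s *\<^sub>R \<zeta> + (b * s) *\<^sub>R \<xi>))"
    using bs by (subst lborel_integral_affine(2)[where c = "b * s" and t = "s *\<^sub>R \<zeta>"]) simp_all
  then show ?thesis
    unfolding eq using bs by (simp add: inv_fourier_wave scaleR_conv_of_real[where 'a = complex])
qed

text \<open>
  The difference of two packets of the same size vanishes at the origin and is there at most proportional
  to \<open>s |x|\<close>. This is what makes sums over dyadic scales bounded.
\<close>

lemma wave_difference_bound:
  fixes x \<zeta> \<zeta>' :: "real ^ 'n"
  assumes "b > 0" "s > 0"
  defines "D \<equiv> real CARD('n) / b"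
  shows "norm (wave b \<zeta> s x - wave b \<zeta>' s x) \<le> norm (\<zeta> - \<zeta>') * (if s * norm x \<le> D then s * norm x else 0)"
proof (cases "cutoff ((b * s) *\<^sub>R x) = 0")
  case True
  then show ?thesis using assms by (simp add: wave_def)
next
  case False
  have "\<bar>x $ i\<bar> \<le> 1 / (b * s)" for i
  proof -
    have "\<bar>((b * s) *\<^sub>R x) $ i\<bar> < 1" using cutoff_eq_0 False by (metis linorder_not_less)
    then have "(b * s) * \<bar>x $ i\<bar> < 1" using assms by (simp add: abs_mult)
    then show ?thesis using assms by (simp add: field_simps)
  qed
  then have "norm x \<le> (\<Sum>i\<in>(UNIV :: 'n set). 1 / (b * s))"
    by (intro order.trans[OF norm_le_l1_cart] sum_mono)
  then have D: "s * norm x \<le> D" using assms by (simp add: field_simps)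
  have "norm (wave b \<zeta> s x - wave b \<zeta>' s x)
      = norm (exp (\<i> * complex_of_real (x \<bullet> (- (s *\<^sub>R \<zeta>)))) - exp (\<i> * complex_of_real (x \<bullet> (- (s *\<^sub>R \<zeta>')))))
        * norm (cutoff ((b * s) *\<^sub>R x))"
    by (simp add: wave_def norm_mult flip: left_diff_distrib)
  also have "\<dots> \<le> \<bar>x \<bullet> (- (s *\<^sub>R \<zeta>)) - x \<bullet> (- (s *\<^sub>R \<zeta>'))\<bar> * 1"
    by (intro mult_mono norm_iexp_diff_le norm_cutoff_le) auto
  also have "\<dots> = s * \<bar>(\<zeta> - \<zeta>') \<bullet> x\<bar>"
  proof -
    have "x \<bullet> (- (s *\<^sub>R \<zeta>)) - x \<bullet> (- (s *\<^sub>R \<zeta>')) = - (s * ((\<zeta> - \<zeta>') \<bullet> x))"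
      using inner_commute[of x \<zeta>] inner_commute[of x \<zeta>'] by (simp add: inner_diff_left right_diff_distrib)
    then show ?thesis using assms by (simp add: abs_mult)
  qed
  also have "\<dots> \<le> s * (norm (\<zeta> - \<zeta>') * norm x)"
    using assms by (intro mult_left_mono Cauchy_Schwarz_ineq2) auto
  finally show ?thesis using D by (simp add: mult_ac)
qed

text \<open>
  At a large scale \<open>s\<close> the pairing with a packet only sees the homogeneous limit \<open>h\<close>: the real or imaginary part converges to
  the average \<open>G b \<zeta>\<close> of \<open>h\<close> near \<open>\<zeta>\<close> on the scale \<open>b\<close>, the same value for every dilate. Since \<open>G b \<zeta> \<rightarrow> h \<zeta> \<integral>\<theta>\<close>
  as \<open>b \<rightarrow> 0\<close>, some \<open>b\<close> gives \<open>G b \<xi>\<^sub>0 \<noteq> G b \<xi>\<^sub>1\<close>. Summing the difference of the packets at \<open>\<xi>\<^sub>0\<close> and \<open>\<xi>\<^sub>1\<close> over \<open>N\<close>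
  dyadic scales multiplies the pairing by \<open>N\<close>, but the supremum norm stays bounded by \<open>D\<close>.
\<close>

lemma unbounded_kernel:
  fixes \<psi> :: "real ^ 'n \<Rightarrow> complex" and part :: "complex \<Rightarrow> real"
  assumes \<psi>[measurable]: "\<psi> \<in> borel_measurable borel" and bdd: "\<And>\<xi>. norm (\<psi> \<xi>) \<le> C"
    and part: "part = Re \<or> part = Im"
    and lim: "\<And>\<xi>. ((\<lambda>s. part (\<psi> (s *\<^sub>R \<xi>))) \<longlongrightarrow> h \<xi>) at_top"
    and cont: "isCont h \<xi>\<^sub>0" "isCont h \<xi>\<^sub>1" and neq: "h \<xi>\<^sub>0 \<noteq> h \<xi>\<^sub>1"
  shows "\<exists>\<eta>\<in>Linf_ball. norm (LINT \<xi>|lborel. \<psi> \<xi> * inv_fourier \<eta> \<xi>) > M"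
proof -
  define \<theta> :: "real ^ 'n \<Rightarrow> real" where "\<theta> \<xi> = Re (inv_fourier cutoff \<xi>)" for \<xi>
  have \<theta>: "inv_fourier cutoff \<xi> = complex_of_real (\<theta> \<xi>)" for \<xi>
    using inv_fourier_cutoff_real[of \<xi>] by (simp add: \<theta>_def)
  have \<theta>_int: "integrable lborel \<theta>"
    unfolding \<theta>_def[abs_def] by (intro integrable_Re integrable_inv_fourier_cutoff)
  have \<theta>_integral: "(LINT \<xi>|lborel. \<theta> \<xi>) > 0"
    using integral_inv_fourier_cutoff[where 'n = 'n] integrable_inv_fourier_cutoff[where 'n = 'n] bump_0
    by (simp add: \<theta>_def)
  have [measurable]: "\<theta> \<in> borel_measurable borel" using \<theta>_int by (simp add: borel_measurable_integrable)
  have part_le: "\<bar>part z\<bar> \<le> norm z" for z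
    using part abs_Re_le_cmod abs_Im_le_cmod by auto
  have part_meas[measurable]: "part \<in> borel_measurable borel" using part by auto
  have part_bdd: "\<bar>part (\<psi> \<xi>)\<bar> \<le> C" for \<xi> using part_le bdd order.trans by blast
  have lim_seq: "(\<lambda>m. part (\<psi> (X m *\<^sub>R \<xi>))) \<longlonglongrightarrow> h \<xi>" if "filterlim X at_top sequentially" for X \<xi>
    using filterlim_compose[OF lim that] .
  have real_top: "filterlim (\<lambda>m. real (Suc m)) at_top sequentially"
    by (rule filterlim_compose[OF filterlim_real_sequentially filterlim_Suc])
  have [measurable]: "h \<in> borel_measurable borel"
    by (rule borel_measurable_LIMSEQ_real[where u = "\<lambda>m \<xi>. part (\<psi> (real (Suc m) *\<^sub>R \<xi>))"])
      (use lim_seq[OF real_top] in \<open>auto simp del: of_nat_Suc\<close>)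
  have h_bdd: "\<bar>h \<xi>\<bar> \<le> C" for \<xi>
    by (rule LIMSEQ_le_const2[OF tendsto_rabs[OF lim_seq[OF real_top]]]) (use part_bdd in auto)

  \<comment> \<open>Averages of the homogeneous limit, and the choice of the width \<open>b\<close>.\<close>
  define G where "G b \<zeta> = (LINT \<xi>|lborel. h (\<zeta> + b *\<^sub>R \<xi>) * \<theta> \<xi>)" for b \<zeta>
  have G_lim: "(\<lambda>m. G (1 / real (Suc m)) \<zeta>) \<longlonglongrightarrow> h \<zeta> * (LINT \<xi>|lborel. \<theta> \<xi>)" if "isCont h \<zeta>" for \<zeta>
  proof -
    have "(\<lambda>m. G (1 / real (Suc m)) \<zeta>) \<longlonglongrightarrow> (LINT \<xi>|lborel. h \<zeta> * \<theta> \<xi>)"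
      unfolding G_def
    proof (rule integral_dominated_convergence[where w = "\<lambda>\<xi>. C * \<bar>\<theta> \<xi>\<bar>"])
      have "(\<lambda>m. h (\<zeta> + (1 / real (Suc m)) *\<^sub>R \<xi>)) \<longlonglongrightarrow> h \<zeta>" for \<xi>
      proof (rule isCont_tendsto_compose[OF that])
        have "(\<lambda>m. \<zeta> + (1 / real (Suc m)) *\<^sub>R \<xi>) \<longlonglongrightarrow> \<zeta> + 0 *\<^sub>R \<xi>"
          by (intro tendsto_add tendsto_scaleR LIMSEQ_Suc[OF lim_const_over_n] tendsto_const)
        then show "(\<lambda>m. \<zeta> + (1 / real (Suc m)) *\<^sub>R \<xi>) \<longlonglongrightarrow> \<zeta>" by simp
      qed
      then show "AE \<xi> in lborel. (\<lambda>m. h (\<zeta> + (1 / real (Suc m)) *\<^sub>R \<xi>) * \<theta> \<xi>) \<longlonglongrightarrow> h \<zeta> * \<theta> \<xi>"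
        by (intro AE_I2 tendsto_mult tendsto_const)
    qed (use \<theta>_int h_bdd in \<open>auto simp: abs_mult intro!: mult_right_mono\<close>)
    then show ?thesis by simp
  qed
  have "(\<lambda>m. G (1 / real (Suc m)) \<xi>\<^sub>0 - G (1 / real (Suc m)) \<xi>\<^sub>1)
      \<longlonglongrightarrow> h \<xi>\<^sub>0 * (LINT \<xi>|lborel. \<theta> \<xi>) - h \<xi>\<^sub>1 * (LINT \<xi>|lborel. \<theta> \<xi>)"
    by (intro tendsto_diff G_lim cont)
  moreover have "h \<xi>\<^sub>0 * (LINT \<xi>|lborel. \<theta> \<xi>) - h \<xi>\<^sub>1 * (LINT \<xi>|lborel. \<theta> \<xi>) \<noteq> 0"
    using neq \<theta>_integral by simp
  ultimately have "\<forall>\<^sub>F m in sequentially. G (1 / real (Suc m)) \<xi>\<^sub>0 - G (1 / real (Suc m)) \<xi>\<^sub>1 \<noteq> 0"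
    by (rule tendsto_imp_eventually_ne)
  then obtain m where m: "G (1 / real (Suc m)) \<xi>\<^sub>0 - G (1 / real (Suc m)) \<xi>\<^sub>1 \<noteq> 0"
    using eventually_happens'[OF sequentially_bot] by blast
  define b where "b = 1 / real (Suc m)"
  define g where "g = G b \<xi>\<^sub>0 - G b \<xi>\<^sub>1"
  have b: "b > 0" and g: "g \<noteq> 0" using m by (simp_all add: b_def g_def)

  \<comment> \<open>The pairing with a packet at scale \<open>s\<close> converges to the average as \<open>s \<rightarrow> \<infinity>\<close>.\<close>
  define P where "P \<zeta> s = part (LINT \<xi>|lborel. \<psi> \<xi> * inv_fourier (wave b \<zeta> s) \<xi>)" for \<zeta> s
  have P_lim: "(\<lambda>m. P \<zeta> (X m)) \<longlonglongrightarrow> G b \<zeta>"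
    if X: "filterlim X at_top sequentially" and X_pos: "\<And>m. X m > 0" for X \<zeta>
  proof -
    have P: "P \<zeta> (X m) = (LINT \<xi>|lborel. part (\<psi> (X m *\<^sub>R (\<zeta> + b *\<^sub>R \<xi>))) * \<theta> \<xi>)" for m
    proof -
      have int: "integrable lborel (\<lambda>\<xi>. \<psi> (X m *\<^sub>R (\<zeta> + b *\<^sub>R \<xi>)) * complex_of_real (\<theta> \<xi>))"
        using \<theta>_int bdd by (intro integrable_symbol_mult) auto
      have "part (LINT \<xi>|lborel. \<psi> (X m *\<^sub>R (\<zeta> + b *\<^sub>R \<xi>)) * complex_of_real (\<theta> \<xi>))
          = (LINT \<xi>|lborel. part (\<psi> (X m *\<^sub>R (\<zeta> + b *\<^sub>R \<xi>)) * complex_of_real (\<theta> \<xi>)))"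
        using part by (elim disjE) (simp_all only: integral_Re[OF int] integral_Im[OF int])
      moreover have "part (z * complex_of_real r) = part z * r" for z r using part by auto
      ultimately show ?thesis
        unfolding P_def integral_symbol_wave[OF \<psi> b X_pos] \<theta> by (simp only:)
    qed
    show ?thesis
      unfolding P G_def
    proof (rule integral_dominated_convergence[where w = "\<lambda>\<xi>. C * \<bar>\<theta> \<xi>\<bar>"])
      show "AE \<xi> in lborel. (\<lambda>m. part (\<psi> (X m *\<^sub>R (\<zeta> + b *\<^sub>R \<xi>))) * \<theta> \<xi>) \<longlonglongrightarrow> h (\<zeta> + b *\<^sub>R \<xi>) * \<theta> \<xi>"
        by (intro AE_I2 tendsto_mult tendsto_const lim_seq X)
    qed (use \<theta>_int part_bdd in \<open>auto simp: abs_mult intro!: mult_right_mono\<close>)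
  qed

  \<comment> \<open>The summand \<open>1\<close> only makes \<open>D\<close> positive; the rest is the bound from \<open>dyadic_sum_le\<close>.\<close>
  define D where "D = norm (\<xi>\<^sub>0 - \<xi>\<^sub>1) * (2 * (real CARD('n) / b)) + 1"
  have D: "D > 0" using b by (simp add: D_def add_nonneg_pos)
  obtain N :: nat where N: "(\<bar>M\<bar> + 1) * D / \<bar>g\<bar> < N" using reals_Archimedean2 by blast
  define \<eta> where "\<eta> s x = complex_of_real (1 / D) * (\<Sum>k<N. wave b \<xi>\<^sub>0 (2 ^ k * s) x - wave b \<xi>\<^sub>1 (2 ^ k * s) x)" for s x
  have \<eta>_eq: "inv_fourier (\<eta> s) \<xi> = complex_of_real (1 / D) *
      (\<Sum>k<N. inv_fourier (wave b \<xi>\<^sub>0 (2 ^ k * s)) \<xi> - inv_fourier (wave b \<xi>\<^sub>1 (2 ^ k * s)) \<xi>)"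
    and \<eta>_ball: "\<eta> s \<in> Linf_ball"
    and \<eta>_integral: "part (LINT \<xi>|lborel. \<psi> \<xi> * inv_fourier (\<eta> s) \<xi>) =
      1 / D * (\<Sum>k<N. P \<xi>\<^sub>0 (2 ^ k * s) - P \<xi>\<^sub>1 (2 ^ k * s))"
    \<comment> \<open>The condition on \<open>s\<close> puts the supports of all packets into the unit cube.\<close>
    if s: "b * s \<ge> 1" for s \<xi>
  proof -
    have s_pos: "s > 0" using s b by (smt (verit) mult_nonneg_nonpos)
    have "b * (2 ^ k * s) \<ge> 1" for k :: nat
    proof -
      have "1 * 1 \<le> 2 ^ k * (b * s)" using s by (intro mult_mono) auto
      then show ?thesis by (simp add: mult_ac)
    qed
    then have tests: "wave b \<zeta> (2 ^ k * s) \<in> cube_tests" for k :: nat and \<zeta> :: "real ^ 'n"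
      by (intro wave_cube_tests b)
    note int = cube_tests_integrable[OF tests]
    show eq: "inv_fourier (\<eta> s) \<xi> = complex_of_real (1 / D) *
      (\<Sum>k<N. inv_fourier (wave b \<xi>\<^sub>0 (2 ^ k * s)) \<xi> - inv_fourier (wave b \<xi>\<^sub>1 (2 ^ k * s)) \<xi>)" for \<xi>
      unfolding \<eta>_def[abs_def] inv_fourier_cmult
      using int by (subst inv_fourier_sum) (auto simp: inv_fourier_diff)
    have wave_int: "integrable lborel (inv_fourier (wave b \<zeta> (2 ^ k * s)))" for k :: nat and \<zeta> :: "real ^ 'n"
      using tests by (simp add: cube_tests_def)
    have "\<eta> s = (\<lambda>x. complex_of_real (1 / D) *
        (\<Sum>k<N. wave b \<xi>\<^sub>0 (2 ^ k * s) x + (-1) * wave b \<xi>\<^sub>1 (2 ^ k * s) x))"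
      by (simp add: \<eta>_def[abs_def])
    also have "\<dots> \<in> flat_algebra"
      by (intro flat_algebra.mult flat_algebra.const flat_algebra_sum flat_algebra.add wave_flat_algebra) simp
    finally have alg: "\<eta> s \<in> flat_algebra" .
    have "\<eta> s \<in> cube_tests"
      using alg tests wave_int by (auto simp: cube_tests_def eq[abs_def] \<eta>_def)
    moreover have "norm (\<eta> s x) \<le> 1" for x
    proof -
      let ?L = "norm (\<xi>\<^sub>0 - \<xi>\<^sub>1)" and ?D = "real CARD('n) / b"
      have "norm (\<Sum>k<N. wave b \<xi>\<^sub>0 (2 ^ k * s) x - wave b \<xi>\<^sub>1 (2 ^ k * s) x)
          \<le> (\<Sum>k<N. ?L * (if 2 ^ k * s * norm x \<le> ?D then 2 ^ k * s * norm x else 0))"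
        using b s_pos by (intro sum_norm_le wave_difference_bound) auto
      also have "\<dots> = ?L * (\<Sum>k<N. if 2 ^ k * (s * norm x) \<le> ?D then 2 ^ k * (s * norm x) else 0)"
        by (simp only: sum_distrib_left mult.assoc)
      also have "\<dots> \<le> ?L * (2 * ?D)"
        using b s_pos by (intro mult_left_mono dyadic_sum_le) auto
      also have "\<dots> \<le> D" by (simp add: D_def)
      finally show ?thesis using D by (simp add: \<eta>_def norm_mult norm_divide)
    qed
    ultimately show "\<eta> s \<in> Linf_ball" by simp
    have "(LINT \<xi>|lborel. \<psi> \<xi> * inv_fourier (\<eta> s) \<xi>) = complex_of_real (1 / D) *
        (\<Sum>k<N. (LINT \<xi>|lborel. \<psi> \<xi> * inv_fourier (wave b \<xi>\<^sub>0 (2 ^ k * s)) \<xi>)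
          - (LINT \<xi>|lborel. \<psi> \<xi> * inv_fourier (wave b \<xi>\<^sub>1 (2 ^ k * s)) \<xi>))"
      unfolding eq using integrable_symbol_mult[OF \<psi> bdd wave_int]
      by (simp add: sum_distrib_left right_diff_distrib mult.left_commute[of "\<psi> _"] integral_sum)
    moreover have "part (complex_of_real r * z) = r * part z" "part (\<Sum>k<N. f k - g k) = (\<Sum>k<N. part (f k) - part (g k))"
      for r z and f g :: "nat \<Rightarrow> complex"
      using part by auto
    ultimately show "part (LINT \<xi>|lborel. \<psi> \<xi> * inv_fourier (\<eta> s) \<xi>) =
      1 / D * (\<Sum>k<N. P \<xi>\<^sub>0 (2 ^ k * s) - P \<xi>\<^sub>1 (2 ^ k * s))"
      by (simp only: P_def)
  qed
  have "(\<lambda>m. 1 / D * (\<Sum>k<N. P \<xi>\<^sub>0 (2 ^ k * real (Suc m)) - P \<xi>\<^sub>1 (2 ^ k * real (Suc m))))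
      \<longlonglongrightarrow> 1 / D * (\<Sum>k<N. G b \<xi>\<^sub>0 - G b \<xi>\<^sub>1)"
    by (intro tendsto_mult tendsto_sum tendsto_diff tendsto_const P_lim
        filterlim_tendsto_pos_mult_at_top[OF tendsto_const _ real_top]) auto
  then have "(\<lambda>m. \<bar>1 / D * (\<Sum>k<N. P \<xi>\<^sub>0 (2 ^ k * real (Suc m)) - P \<xi>\<^sub>1 (2 ^ k * real (Suc m)))\<bar>)
      \<longlonglongrightarrow> \<bar>1 / D * (N * g)\<bar>"
    by (intro tendsto_rabs) (simp add: g_def)
  moreover have "M < \<bar>1 / D * (N * g)\<bar>"
  proof -
    have "(\<bar>M\<bar> + 1) * D < N * \<bar>g\<bar>" using N g by (simp add: field_simps)
    then have "\<bar>M\<bar> + 1 < N * \<bar>g\<bar> / D" using D by (simp add: field_simps)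
    then show ?thesis using D by (simp add: abs_mult)
  qed
  ultimately have "\<forall>\<^sub>F m in sequentially.
      M < \<bar>1 / D * (\<Sum>k<N. P \<xi>\<^sub>0 (2 ^ k * real (Suc m)) - P \<xi>\<^sub>1 (2 ^ k * real (Suc m)))\<bar>"
    by (rule order_tendstoD(1))
  moreover have "\<forall>\<^sub>F m in sequentially. 1 / b \<le> real (Suc m)"
    using real_top by (simp add: filterlim_at_top)
  ultimately have "\<forall>\<^sub>F m in sequentially.
      M < \<bar>1 / D * (\<Sum>k<N. P \<xi>\<^sub>0 (2 ^ k * real (Suc m)) - P \<xi>\<^sub>1 (2 ^ k * real (Suc m)))\<bar> \<and> 1 / b \<le> real (Suc m)"
    by (rule eventually_conj)
  then obtain m where large: "M < \<bar>1 / D * (\<Sum>k<N. P \<xi>\<^sub>0 (2 ^ k * real (Suc m)) - P \<xi>\<^sub>1 (2 ^ k * real (Suc m)))\<bar>"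
    and "1 / b \<le> real (Suc m)"
    using eventually_happens'[OF sequentially_bot] by blast
  then have s: "b * real (Suc m) \<ge> 1" using b by (simp add: field_simps)
  have "M < norm (LINT \<xi>|lborel. \<psi> \<xi> * inv_fourier (\<eta> (real (Suc m))) \<xi>)"
    using large part_le unfolding \<eta>_integral[OF s, symmetric] by (rule less_le_trans)
  then show ?thesis using \<eta>_ball[OF s] by blast
qed

section \<open>Homogeneous symbols supported in a cone\<close>

text \<open>
  The extension of \<open>h\<close>, from the region \<open>|\<xi>| > R\<close> where it is constant along rays, to a function that is homogeneous
  of degree zero away from the origin. Any radius larger than \<open>R\<close> could replace \<open>R + 1\<close>. At the origin the value is the one that
  makes the limit along \<open>s *\<^sub>R \<xi>\<close> correct for \<open>\<xi> = 0\<close>, too.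
\<close>

definition homogeneous_limit :: "real \<Rightarrow> (real ^ 'n \<Rightarrow> real) \<Rightarrow> real ^ 'n \<Rightarrow> real" where
  "homogeneous_limit R h \<xi> = (if \<xi> = 0 then h 0 else h (((R + 1) / norm \<xi>) *\<^sub>R \<xi>))"

lemma homogeneous_limit_tendsto:
  assumes R: "R > 0" and hom: "\<And>\<xi> l. norm \<xi> > R \<Longrightarrow> l > 1 \<Longrightarrow> h (l *\<^sub>R \<xi>) = h \<xi>"
  shows "((\<lambda>s. h (s *\<^sub>R \<xi>)) \<longlongrightarrow> homogeneous_limit R h \<xi>) at_top"
proof (cases "\<xi> = 0")
  case True
  then show ?thesis by (simp add: homogeneous_limit_def)
next
  case False
  show ?thesis
  proof (rule tendsto_eventually)
    show "\<forall>\<^sub>F s in at_top. h (s *\<^sub>R \<xi>) = homogeneous_limit R h \<xi>"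
      using eventually_gt_at_top[of "(R + 1) / norm \<xi>"]
    proof eventually_elim
      case (elim s)
      let ?\<xi> = "((R + 1) / norm \<xi>) *\<^sub>R \<xi>"
      have "norm ?\<xi> > R" using False R by simp
      moreover have "s * norm \<xi> / (R + 1) > 1" using elim False R by (simp add: field_simps)
      ultimately have "h ((s * norm \<xi> / (R + 1)) *\<^sub>R ?\<xi>) = h ?\<xi>" by (rule hom)
      then show ?case using False R by (simp add: homogeneous_limit_def)
    qed
  qed
qed

lemma homogeneous_limit_continuous:
  assumes "continuous_on UNIV h" "\<xi> \<noteq> 0"
  shows "isCont (homogeneous_limit R h) \<xi>"
proof -
  have ev: "\<forall>\<^sub>F \<xi> in nhds \<xi>. homogeneous_limit R h \<xi> = h (((R + 1) / norm \<xi>) *\<^sub>R \<xi>)"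
    using t1_space_nhds[OF assms(2)] by eventually_elim (simp add: homogeneous_limit_def)
  have "isCont (\<lambda>\<xi>. h (((R + 1) / norm \<xi>) *\<^sub>R \<xi>)) \<xi>"
  proof (rule isCont_o2[where f = "\<lambda>\<xi>. ((R + 1) / norm \<xi>) *\<^sub>R \<xi>" and g = h])
    show "isCont (\<lambda>\<xi>. ((R + 1) / norm \<xi>) *\<^sub>R \<xi>) \<xi>"
      using assms(2) by (intro continuous_scaleR continuous_divide continuous_norm continuous_const continuous_ident) auto
    show "isCont h (((R + 1) / norm \<xi>) *\<^sub>R \<xi>)"
      using assms(1) by (simp add: continuous_on_eq_continuous_at)
  qed
  then show ?thesis unfolding isCont_cong[OF ev] .
qed

lemma condition_star_nonzero:
  assumes "condition_star V \<phi>"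
  shows "\<exists>\<omega>\<in>sphere 0 1. \<phi> \<omega> \<noteq> 0"
proof (rule ccontr)
  assume "\<not> ?thesis"
  then have 0: "\<phi> \<omega> = 0" if "\<omega> \<in> space sphere_measure" for \<omega>
    using that by (auto simp: sphere_measure_def space_scale_measure space_restrict_space)
  have "(LINT \<omega>|sphere_measure. pos_part \<phi> \<omega>) = 0"
  proof -
    have "pos_part \<phi> \<omega> = 0" if "\<omega> \<in> space sphere_measure" for \<omega>
      using 0[OF that] by (simp add: pos_part_def)
    then show ?thesis
      using Bochner_Integration.integral_cong[of sphere_measure sphere_measure "pos_part \<phi>" "\<lambda>_. 0"] by simp
  qed
  moreover have "(LINT \<omega>|sphere_measure. neg_part \<phi> \<omega>) = 0"
  proof -
    have "neg_part \<phi> \<omega> = 0" if "\<omega> \<in> space sphere_measure" for \<omega>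
      using 0[OF that] by (simp add: neg_part_def)
    then show ?thesis
      using Bochner_Integration.integral_cong[of sphere_measure sphere_measure "neg_part \<phi>" "\<lambda>_. 0"] by simp
  qed
  ultimately show False
    using assms by (simp add: condition_star_def zero_ereal_def[symmetric])
qed

text \<open>
  The half-space \<open>{y. w \<bullet> y \<ge> 0}\<close> contains \<open>V\<close> and excludes \<open>-w\<close>. That \<open>w\<close> is not zero holds because a
  neighbourhood of zero inside the dual cone would contain a negative multiple of a vector of \<open>V\<close>.
\<close>

lemma interior_dual_cone_minus_notin:
  assumes "V - {0} \<noteq> {}" "w \<in> interior (dual_cone V)"
  shows "w \<noteq> 0" "- w \<notin> V"
proof -
  obtain y where y: "y \<in> V" "y \<noteq> 0" using assms(1) by blast
  show "w \<noteq> 0"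
  proof
    assume "w = 0"
    then obtain e where e: "e > 0" "ball 0 e \<subseteq> dual_cone V"
      using assms(2) by (auto simp: mem_interior)
    define c where "c = e / (2 * norm y)"
    have c: "c > 0" using e y by (simp add: c_def)
    have "- c *\<^sub>R y \<in> ball 0 e" using e y by (simp add: c_def)
    then have "- c *\<^sub>R y \<in> dual_cone V" using e by blast
    then have "(- c *\<^sub>R y) \<bullet> y \<ge> 0" using y(1) unfolding dual_cone_def by blast
    then have "c * (y \<bullet> y) \<le> 0" by simp
    moreover have "c * (y \<bullet> y) > 0" using c y by simp
    ultimately show False by linarith
  qed
  moreover have "w \<in> dual_cone V" using assms(2) interior_subset by blast
  ultimately show "- w \<notin> V"
  proof (intro notI)
    assume w: "w \<noteq> 0" "w \<in> dual_cone V" "- w \<in> V"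
    then have "w \<bullet> (- w) \<ge> 0" unfolding dual_cone_def by blast
    moreover have "w \<bullet> w > 0" using w(1) by simp
    ultimately show False by simp
  qed
qed

theorem theorem2p10:
  fixes V :: "(real ^ 'n) set" and \<psi> :: "real ^ 'n \<Rightarrow> complex" and part :: "complex \<Rightarrow> real"
  assumes "closed V" and "pos_cone V" and "V - {0} \<noteq> {}"
    and "interior (dual_cone V) \<noteq> {}"
    and "symbol_S0 \<psi>"
    and "part = Re \<or> part = Im"
    and "pos_homogeneous0 (\<lambda>\<xi>. part (\<psi> \<xi>))"
    and "supp (\<lambda>\<xi>. part (\<psi> \<xi>)) \<subseteq> V"
    and "condition_star V (radial_limit (\<lambda>\<xi>. part (\<psi> \<xi>))) \<or>
         condition_star V (\<lambda>\<omega>. - radial_limit (\<lambda>\<xi>. part (\<psi> \<xi>)) \<omega>)"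
  shows "\<exists>f \<in> L1_comp. \<exists>g \<in> Linf_comp. \<exists>\<phi> \<in> cont_comp.
           \<not> given_by_elem (psi_D \<psi> (dist_of f)) L1_loc \<and>
           \<not> given_by_elem (psi_D \<psi> (dist_of g)) Linf_loc \<and>
           \<not> given_by_elem (psi_D \<psi> (dist_of \<phi>)) cont_functions"
proof -
  let ?h = "\<lambda>\<xi>. part (\<psi> \<xi>)"
  have "\<psi> differentiable (at \<xi>)" for \<xi>
    using \<open>symbol_S0 \<psi>\<close> unfolding symbol_S0_def smooth_def iter_deriv_def by (auto dest: spec[of _ "[]"])
  then have cont: "continuous_on UNIV \<psi>"
    by (intro continuous_at_imp_continuous_on ballI differentiable_imp_continuous_within)
  have "\<forall>is. bdd_above (range (\<lambda>\<xi>. japanese_bracket \<xi> ^ length is * norm (iter_deriv is \<psi> \<xi>)))"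
    using \<open>symbol_S0 \<psi>\<close> by (simp add: symbol_S0_def)
  from spec[OF this, of "[]"] obtain C where C: "\<And>\<xi>. norm (\<psi> \<xi>) \<le> C" by (auto simp: iter_deriv_def bdd_above_def)
  have meas: "\<psi> \<in> borel_measurable borel" using cont by (rule borel_measurable_continuous_onI)
  have h_cont: "continuous_on UNIV ?h" using assms(6) cont by (auto intro: continuous_intros)

  obtain R where R: "R > 0" "\<And>\<xi> l. norm \<xi> > R \<Longrightarrow> l > 1 \<Longrightarrow> ?h (l *\<^sub>R \<xi>) = ?h \<xi>"
    using assms(7) unfolding pos_homogeneous0_def by blast
  define h\<^sub>0 where "h\<^sub>0 = homogeneous_limit R ?h"
  have lim: "((\<lambda>s. ?h (s *\<^sub>R \<xi>)) \<longlongrightarrow> h\<^sub>0 \<xi>) at_top" for \<xi>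
    unfolding h\<^sub>0_def using R by (rule homogeneous_limit_tendsto)
  have radial: "radial_limit ?h \<omega> = h\<^sub>0 \<omega>" for \<omega>
    unfolding radial_limit_def by (rule tendsto_Lim[OF _ lim]) simp
  obtain \<omega> where \<omega>: "\<omega> \<in> sphere 0 1" "h\<^sub>0 \<omega> \<noteq> 0"
    using assms(9) condition_star_nonzero unfolding radial by fastforce

  obtain w where "w \<in> interior (dual_cone V)" using assms(4) by blast
  note w = interior_dual_cone_minus_notin[OF assms(3) this]
  define t where "t = (R + 1) / norm (- w)"
  have t: "t > 0" using R(1) w(1) by (simp add: t_def)
  \<comment> \<open>On the ray through \<open>- w\<close> the symbol vanishes, which gives a second value of the limit.\<close>
  have "t *\<^sub>R (- w) \<notin> V"
  proof
    assume "t *\<^sub>R (- w) \<in> V"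
    then have "(1 / t) *\<^sub>R (t *\<^sub>R (- w)) \<in> V" using assms(2) t unfolding pos_cone_def by (meson divide_pos_pos zero_less_one)
    then show False using w(2) t by simp
  qed
  then have "?h (t *\<^sub>R (- w)) = 0"
    using assms(8) closure_subset[of "{\<xi>. ?h \<xi> \<noteq> 0}"] unfolding supp_def by blast
  then have "h\<^sub>0 (- w) = 0" using w(1) by (simp add: h\<^sub>0_def homogeneous_limit_def t_def)
  then have neq: "h\<^sub>0 \<omega> \<noteq> h\<^sub>0 (- w)" using \<omega>(2) by simp
  have "isCont h\<^sub>0 \<omega>" "isCont h\<^sub>0 (- w)"
    unfolding h\<^sub>0_def using \<omega>(1) w(1) by (auto intro!: homogeneous_limit_continuous h_cont)
  from unbounded_kernel[OF meas C assms(6) lim this neq] show ?thesis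
    by (rule ill_posed[OF meas C])
qed

end
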